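(* Let $X=\{x_1,\dots,x_n\}\subset\mathbb{R}^p$ be in general position about $t$, let $n>p(p-1)$, and let $u$ satisfy the conditions listed in the context, with $K=\sup_{s>0}su(s)>p$. Put $$a_1=1-\frac{np}{nK-(K-n)(p-1)},\quad a_2=1-\frac{np}{nK+n-K},\quad a_3=1-\frac{n(p-1)}{(n-p+1)K},\quad a_4=1-\frac{n(p-1)}{(n-1)K}.$$ Let $r>0$ and $B<\infty$. For the sequence $C_{2,r,m}(X)\cap C_{3,B,m}(X)$, $m=1,2,\dots$: $\min(a_2,a_3)\le\delta^*(X)\le a_4$ when $n>K$, and $a_1\le\delta^*(X)\le a_4$ when $n\le K$.
   Context: Fix a dimension $p$, a center $t\in\mathbb{R}^p$ and a function $u:[0,\infty)\to\mathbb{R}$. Put $\psi(s)=su(s)$ and $K=\sup_{s>0}\psi(s)$. Conditions on $u$: (i) $u(s)$ is non-negative, non-increasing and continuous for $s>0$; (ii) $u(s)$ and $su(s)$ are bounded; (iii) $\psi$ is non-decreasing on $s>0$ and strictly increasing on $\{s>0:\psi(s)<K\}$; (iv) $K>p$. For a finite collection (multiset) $Z=\{z_1,\dots,z_N\}$ of points of $\mathbb{R}^p$, the $M$-estimate of scatter $V_N(Z)$ about $t$ is a symmetric positive definite matrix $V$ satisfying $$V=\frac1N\sum_{i=1}^N u(s_i)(z_i-t)(z_i-t)',\qquad s_i=(z_i-t)'V^{-1}(z_i-t).$$ We say $V_N(Z)$ exists if such a $V$ exists. $X=\{x_1,\dots,x_n\}$ is in general position about $t$ if for every $p$ of the points,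 the vectors $x_i-t$ span $\mathbb{R}^p$. Under the assumptions made ($X$ in general position about $t$, $n>p(p-1)$), $V_n(X)$ exists and is unique. For $m\ge1$ and a multiset $Y=\{y_1,\dots,y_m\}$ of points of $\mathbb{R}^p$, let $Z=X\cup Y$ be the combined multiset of $n+m$ points, and $\epsilon_m=m/(n+m)$. Let $S_m(X)$ be the set of $Z=X\cup Y$ for which $V_{n+m}(Z)$ exists (it is then unique). Define $C_{2,r,m}(X)=\{Y:\min_{1\le i\le m}(y_i-t)'(y_i-t)>r\}$ and $C_{3,B,m}(X)=\{Y:\max_{1\le i\le m}(y_i-t)'(y_i-t)<B\}$, where $Y$ ranges over collections of size $m$. Breakdown for a sequence of classes $C_1(X),C_2(X),\dots$, where $C_m(X)$ consists of collections $Y$ of size $m$: let $b(\epsilon_m;X)=\infty$ if some $Y\in C_m(X)$ gives $Z=X\cup Y\notin S_m(X)$, and otherwise $$b(\epsilon_m;X)=\sup_{Y\in C_m(X)}\mathrm{trace}\{V_{n+m}(Z)V_n(X)^{-1}+V_n(X)V_{n+m}(Z)^{-1}\}.$$ Only $m\ge1$ with $C_m(X)\neq\emptyset$ are considered. For the given sequence, $\delta^*(X)$ denotes a fraction such that $b(\epsilon_m;X)=\infty$ if $\epsilon_m>\delta^*(X)$ and $b(\epsilon_m;X)<\infty$ if $\epsilon_m<\delta^*(X)$. It is not unique, since the values $\epsilon_m$ are discrete; "$L\le\delta^*(X)\le U$" means that $b(\epsilon_m;X)<\infty$ whenever $\epsilon_m<L$ and $b(\epsilon_m;X)=\infty$ whenever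 $\epsilon_m>U$. *)

theory Defs
  imports "HOL-Analysis.Analysis" "HOL-Library.Multiset"
begin

definition psi :: "(real \<Rightarrow> real) \<Rightarrow> real \<Rightarrow> real" where
  "psi u s = s * u s"

definition psi_sup :: "(real \<Rightarrow> real) \<Rightarrow> real" where
  "psi_sup u = (SUP s\<in>{0<..}. psi u s)"

(* Only the values of u on [0, \<infinity>) matter. *)
definition weight_function :: "(real \<Rightarrow> real) \<Rightarrow> bool" where
  "weight_function u \<longleftrightarrow>
     (\<forall>s>0. 0 \<le> u s) \<and> antimono_on {0<..} u \<and> continuous_on {0<..} u \<and>
     bounded (u ` {0..}) \<and> bounded (psi u ` {0..}) \<and>
     mono_on {0<..} (psi u) \<and> strict_mono_on {s. 0 < s \<and> psi u s < psi_sup u} (psi u)"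

definition sym_pos_def :: "real^'p^'p \<Rightarrow> bool" where
  "sym_pos_def V \<longleftrightarrow> transpose V = V \<and> (\<forall>x. x \<noteq> 0 \<longrightarrow> 0 < x \<bullet> (V *v x))"

definition outer_square :: "real^'p \<Rightarrow> real^'p^'p" where
  "outer_square x = (\<chi> i j. x $ i * x $ j)"

definition is_scatter ::
    "(real \<Rightarrow> real) \<Rightarrow> real^'p \<Rightarrow> (real^'p) multiset \<Rightarrow> real^'p^'p \<Rightarrow> bool" where
  "is_scatter u t Z V \<longleftrightarrow>
     sym_pos_def V \<and>
     V = (1 / real (size Z)) *\<^sub>R
           (\<Sum>z\<in>#Z. u ((z - t) \<bullet> (matrix_inv V *v (z - t))) *\<^sub>R
              outer_square (z - t))"

definition scatter_exists :: "(real \<Rightarrow> real) \<Rightarrow> real^'p \<Rightarrow> (real^'p) multiset \<Rightarrow> bool" where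
  "scatter_exists u t Z \<longleftrightarrow> (\<exists>V. is_scatter u t Z V)"

(* Meaningful only where the M-estimate exists and is unique. *)
definition scatter :: "(real \<Rightarrow> real) \<Rightarrow> real^'p \<Rightarrow> (real^'p) multiset \<Rightarrow> real^'p^'p" where
  "scatter u t Z = (THE V. is_scatter u t Z V)"

(* Points are counted with multiplicity: a repeated point can be selected repeatedly. *)
definition general_position_about :: "real^'p \<Rightarrow> (real^'p) multiset \<Rightarrow> bool" where
  "general_position_about t X \<longleftrightarrow>
     (\<forall>W. W \<subseteq># X \<and> size W = CARD('p) \<longrightarrow> span ((\<lambda>x. x - t) ` set_mset W) = UNIV)"

definition contam_frac :: "(real^'p) multiset \<Rightarrow> nat \<Rightarrow> real" where
  "contam_frac X m = real m / real (size X + m)"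

(* The classes C2 and C3 are used for m \<ge> 1 only, so Min and Max range over nonempty sets. *)
definition C2 :: "real^'p \<Rightarrow> real \<Rightarrow> nat \<Rightarrow> (real^'p) multiset set" where
  "C2 t r m = {Y. size Y = m \<and> Min ((\<lambda>y. (y - t) \<bullet> (y - t)) ` set_mset Y) > r}"

definition C3 :: "real^'p \<Rightarrow> real \<Rightarrow> nat \<Rightarrow> (real^'p) multiset set" where
  "C3 t B m = {Y. size Y = m \<and> Max ((\<lambda>y. (y - t) \<bullet> (y - t)) ` set_mset Y) < B}"

definition breakdown_bias ::
    "(real \<Rightarrow> real) \<Rightarrow> real^'p \<Rightarrow> (real^'p) multiset \<Rightarrow> (real^'p) multiset set \<Rightarrow> ereal" where
  "breakdown_bias u t X C =
     (if \<exists>Y\<in>C. \<not> scatter_exists u t (X + Y) then \<infinity>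
      else (SUP Y\<in>C. ereal (trace (scatter u t (X + Y) ** matrix_inv (scatter u t X)
                                + scatter u t X ** matrix_inv (scatter u t (X + Y))))))"

(* L \<le> \<delta>* \<le> U: the breakdown fraction \<delta>* is determined only up to the gaps between the
   discrete values m / (n + m), so the bounds are read as assertions about those values. *)
definition breakdown_fraction_between ::
    "(real \<Rightarrow> real) \<Rightarrow> real^'p \<Rightarrow> (real^'p) multiset \<Rightarrow> (nat \<Rightarrow> (real^'p) multiset set)
       \<Rightarrow> real \<Rightarrow> real \<Rightarrow> bool" where
  "breakdown_fraction_between u t X C L U \<longleftrightarrow>
     (\<forall>m\<ge>1. C m \<noteq> {} \<longrightarrow>
        (contam_frac X m < L \<longrightarrow> breakdown_bias u t X (C m) < \<infinity>) \<and>
        (contam_frac X m > U \<longrightarrow> breakdown_bias u t X (C m) = \<infinity>))"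

end

theory Submission
  imports Defs
begin

text \<open>For \<open>p > 1\<close> the lower bounds \<open>min a2 a3\<close> and (when \<open>n \<le> K\<close>) \<open>a1\<close> are at most \<open>a4\<close>, so it is
  enough to exclude breakdown below \<open>a4\<close>; for \<open>p = 1\<close> there is never breakdown.
  Write \<open>N = n + m\<close>. Below \<open>a4\<close> one has \<open>N q < (n - p + q) K\<close> for \<open>0 < q < p\<close>: by general
  position, a subspace of dimension \<open>d > 0\<close> misses at least \<open>n - d\<close> data points, which is more
  than \<open>N (p - d) / K\<close>. If a matrix \<open>V\<close> dominating its own weighted second-moment matrix had very
  small eigenvalues, there would be a large gap in its spectrum, and all points off the span of
  the large eigenvectors would put weight almost \<open>K\<close> on the remaining \<open>q\<close> eigenvectors, a total
  that exceeds \<open>N q\<close>. So such \<open>V\<close> are bounded below uniformly in \<open>Y\<close>, even if \<open>Y\<close> is unbounded.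
  Existence of the scatter matrix follows by Brouwer's theorem applied to a perturbed fixed-point
  equation, uniqueness by simultaneous diagonalization of two solutions, and boundedness of \<open>Y\<close>
  gives the upper bound. Beyond \<open>a4\<close>, contamination on a line through \<open>t\<close> and one data point
  leaves too few points off that line for a solution to exist.\<close>

section \<open>Symmetric positive definite matrices\<close>

text \<open>A function of \<open>s\<close> that is non-negative and vanishes at 0 has zero
  derivative there. This serves as the first-order condition at a maximum of the Rayleigh
  quotient.\<close>

lemma linear_coefficient_zero:
  fixes a b :: real
  assumes "\<And>s. 0 \<le> 2 * s * b + s\<^sup>2 * a"
  shows "b = 0"
proof (rule ccontr)
  assume b: "b \<noteq> 0"
  have a: "0 \<le> a" using assms[of 1] assms[of "-1"] by simp
  \<comment> \<open>The shift by 1 keeps the denominator positive when \<open>a = 0\<close>, and the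
    quadratic is still negative at this point.\<close>
  define s where "s = - b / (a + 1)"
  have "2 * s * b + s\<^sup>2 * a = - (b\<^sup>2) * (a + 2) / (a + 1)\<^sup>2"
    using a by (simp add: s_def divide_simps) (simp add: algebra_simps power2_eq_square)
  moreover have "- (b\<^sup>2) * (a + 2) / (a + 1)\<^sup>2 < 0"
    using a b by (simp add: divide_neg_pos mult_neg_pos)
  ultimately show False using assms[of s] by linarith
qed

lemma inner_sym_matrix:
  fixes A :: "real^'n^'n"
  assumes "transpose A = A"
  shows "x \<bullet> (A *v y) = y \<bullet> (A *v x)"
proof -
  have "x \<bullet> (A *v y) = (x v* A) \<bullet> y" by (simp add: dot_lmul_matrix)
  also have "x v* A = A *v x" using transpose_matrix_vector[of A x] assms by simp
  finally show ?thesis by (simp add: inner_commute)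
qed

lemma inner_eq_span_UNIV:
  assumes "span B = UNIV" "\<And>b. b \<in> B \<Longrightarrow> b \<bullet> x = b \<bullet> y"
  shows "x = (y :: 'a :: euclidean_space)"
proof -
  have "orthogonal (x - y) z" if "z \<in> span B" for z
  proof (rule orthogonal_to_span[OF that])
    fix b assume "b \<in> B"
    then have "b \<bullet> (x - y) = 0" using assms(2)[of b] by (simp add: inner_diff_right)
    then show "orthogonal (x - y) b" by (simp add: orthogonal_def inner_commute)
  qed
  then show ?thesis using assms(1) by (metis UNIV_I orthogonal_self right_minus_eq)
qed

text \<open>Polarization recovers a symmetric bilinear form from its diagonal, so uniqueness of the
  scatter matrix reduces to comparing quadratic forms.\<close>

lemma sym_matrix_eqI:
  fixes A B :: "real^'n^'n"
  assumes "transpose A = A" "transpose B = B" "\<And>v. v \<bullet> (A *v v) = v \<bullet> (B *v v)"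
  shows "A = B"
proof -
  have "x \<bullet> (A *v y) = x \<bullet> (B *v y)" for x y
    using assms(3)[of "x + y"] assms(3)[of x] assms(3)[of y]
      inner_sym_matrix[OF assms(1), of x y] inner_sym_matrix[OF assms(2), of x y]
    by (simp add: matrix_vector_right_distrib inner_add_left inner_add_right)
  then have "A *v y = B *v y" for y
    by (metis (no_types) inner_eq_span_UNIV span_UNIV)
  then show ?thesis by (simp add: matrix_eq)
qed

lemma spd_inner_pos: "sym_pos_def V \<Longrightarrow> x \<noteq> 0 \<Longrightarrow> 0 < x \<bullet> (V *v x)"
  by (simp add: sym_pos_def_def)

lemma spd_sym: "sym_pos_def V \<Longrightarrow> transpose V = V"
  by (simp add: sym_pos_def_def)

text \<open>Positive definiteness makes the kernel trivial, so the choice operator behind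
  \<open>matrix_inv\<close> does select a two-sided inverse.\<close>

lemma spd_mult_inv:
  fixes V :: "real^'p^'p"
  assumes "sym_pos_def V"
  shows "V *v (matrix_inv V *v x) = x" "matrix_inv V *v (V *v x) = x"
proof -
  have "x = 0" if "V *v x = 0" for x
    using that spd_inner_pos[OF assms, of x] by (cases "x = 0") simp_all
  then have "invertible V"
    using invertible_left_inverse matrix_left_invertible_ker by blast
  then have "V ** matrix_inv V = mat 1 \<and> matrix_inv V ** V = mat 1"
    unfolding invertible_def matrix_inv_def by (rule someI_ex)
  then show "V *v (matrix_inv V *v x) = x" "matrix_inv V *v (V *v x) = x"
    by (simp_all add: matrix_vector_mul_assoc)
qed

lemma spd_inv_form_pos:
  fixes V :: "real^'p^'p"
  assumes "sym_pos_def V" "z \<noteq> 0"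
  shows "0 < z \<bullet> (matrix_inv V *v z)"
proof -
  have "matrix_inv V *v z \<noteq> 0" using spd_mult_inv(1)[OF assms(1), of z] assms(2) by (metis matrix_vector_mult_0_right)
  then have "0 < (matrix_inv V *v z) \<bullet> (V *v (matrix_inv V *v z))"
    by (rule spd_inner_pos[OF assms(1)])
  then show ?thesis by (simp add: spd_mult_inv[OF assms(1)] inner_commute)
qed

text \<open>Orthonormality for the inner product with Gram matrix \<open>G\<close>. Taking
  \<open>G = mat 1\<close> gives the usual notion; taking a scatter matrix as \<open>G\<close>
  allows a second matrix to be diagonalized relative to it. Eigenvalues are later indexed by the
  basis vectors themselves.\<close>

definition form_orthonormal :: "real^'p^'p \<Rightarrow> (real^'p) set \<Rightarrow> bool" where
  "form_orthonormal G B \<longleftrightarrow> finite B \<and>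
     (\<forall>b\<in>B. \<forall>b'\<in>B. b \<bullet> (G *v b') = (if b = b' then 1 else 0))"

lemma form_orthonormal_inner_sum:
  assumes "form_orthonormal G B" "b \<in> B"
  shows "b \<bullet> (G *v (\<Sum>b'\<in>B. f b' *\<^sub>R b')) = f b"
proof -
  have "b \<bullet> (G *v (\<Sum>b'\<in>B. f b' *\<^sub>R b')) = (\<Sum>b'\<in>B. f b' * (b \<bullet> (G *v b')))"
    by (simp add: linear_sum[OF matrix_vector_mul_linear] inner_sum_right matrix_vector_mult_scaleR)
  also have "\<dots> = (\<Sum>b'\<in>B. if b' = b then f b else 0)"
    using assms by (intro sum.cong) (auto simp: form_orthonormal_def)
  also have "\<dots> = f b" using assms by (simp add: form_orthonormal_def)
  finally show ?thesis .
qed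

lemma form_orthonormal_independent:
  assumes "form_orthonormal G B"
  shows "independent B"
proof (rule independent_if_scalars_zero)
  show "finite B" using assms by (simp add: form_orthonormal_def)
  fix f x assume "(\<Sum>b\<in>B. f b *\<^sub>R b) = 0" "x \<in> B"
  then show "f x = 0" using form_orthonormal_inner_sum[OF assms \<open>x \<in> B\<close>, of f] by simp
qed

lemma form_orthonormal_span:
  fixes B :: "(real^'p) set"
  assumes "form_orthonormal G B" "card B = CARD('p)"
  shows "span B = UNIV"
proof -
  have "card B = dim (UNIV :: (real^'p) set)" using assms(2) by simp
  then show ?thesis
    using card_eq_dim[of B UNIV] form_orthonormal_independent[OF assms(1)] assms(1)
    by (auto simp: form_orthonormal_def)
qed

text \<open>Let P have the vectors of \<open>B\<close> as columns. Then P'GP is the identity and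
  P'HP is diagonal with entries \<open>\<mu> b\<close>, so the inverse of \<open>H\<close> is P
  diag(1/\<mu>) P'. Hence the coordinates \<open>z \<bullet> b\<close> are Euclidean products in
  which \<open>G\<close> does not appear.\<close>

lemma form_orthonormal_inv:
  fixes G H :: "real^'p^'p"
  assumes B: "form_orthonormal G B" "card B = CARD('p)" and H: "sym_pos_def H"
    and eig: "\<And>b. b \<in> B \<Longrightarrow> H *v b = \<mu> b *\<^sub>R (G *v b)"
  shows "\<And>b. b \<in> B \<Longrightarrow> 0 < \<mu> b"
    and "z \<bullet> (matrix_inv H *v z) = (\<Sum>b\<in>B. (z \<bullet> b)\<^sup>2 / \<mu> b)"
proof -
  have bb: "b \<bullet> (G *v b) = 1" if "b \<in> B" for b
    using B(1) that by (simp add: form_orthonormal_def)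
  show pos: "0 < \<mu> b" if "b \<in> B" for b
  proof -
    have "b \<noteq> 0" using bb[OF that] by auto
    from spd_inner_pos[OF H this] show ?thesis using eig[OF that] bb[OF that] by simp
  qed
  define w where "w = (\<Sum>b\<in>B. ((z \<bullet> b) / \<mu> b) *\<^sub>R b)"
  have "b \<bullet> (H *v w) = b \<bullet> z" if "b \<in> B" for b
  proof -
    have "H *v w = (\<Sum>b\<in>B. ((z \<bullet> b) / \<mu> b) *\<^sub>R (H *v b))"
      by (simp add: w_def linear_sum[OF matrix_vector_mul_linear] matrix_vector_mult_scaleR)
    also have "\<dots> = (\<Sum>b\<in>B. (z \<bullet> b) *\<^sub>R (G *v b))"
      using pos by (intro sum.cong) (auto simp: eig less_imp_neq[symmetric])
    also have "\<dots> = G *v (\<Sum>b\<in>B. (z \<bullet> b) *\<^sub>R b)"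
      by (simp add: linear_sum[OF matrix_vector_mul_linear] matrix_vector_mult_scaleR)
    finally show ?thesis using form_orthonormal_inner_sum[OF B(1) that, of "\<lambda>b. z \<bullet> b"]
      by (simp add: inner_commute)
  qed
  then have "H *v w = z"
    using inner_eq_span_UNIV[OF form_orthonormal_span[OF B]] by metis
  then have "matrix_inv H *v z = w" using spd_mult_inv(2)[OF H, of w] by simp
  then show "z \<bullet> (matrix_inv H *v z) = (\<Sum>b\<in>B. (z \<bullet> b)\<^sup>2 / \<mu> b)"
    by (simp add: w_def inner_sum_right power2_eq_square)
qed

lemma continuous_on_quadratic_form [continuous_intros]:
  fixes A :: "'a::topological_space \<Rightarrow> real^'p^'p"
  assumes "continuous_on S A" "continuous_on S f" "continuous_on S g"
  shows "continuous_on S (\<lambda>x. f x \<bullet> (A x *v g x))"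
  unfolding matrix_vector_mult_def using assms
  by (intro continuous_intros)

text \<open>The minimum of the form on the compact unit sphere is positive and, by homogeneity,
  serves as the constant.\<close>

lemma sym_pos_def_lower_bound:
  fixes V :: "real^'p^'p"
  assumes "sym_pos_def V"
  obtains c where "0 < c" "\<And>v. c * (v \<bullet> v) \<le> v \<bullet> (V *v v)"
proof -
  have ne: "sphere (0 :: real^'p) 1 \<noteq> {}" by simp
  have "continuous_on (sphere (0 :: real^'p) 1) (\<lambda>x. x \<bullet> (V *v x))"
    by (intro continuous_intros)
  from continuous_attains_inf[OF compact_sphere ne this]
  obtain x where x: "norm x = 1" "\<And>y. norm y = 1 \<Longrightarrow> x \<bullet> (V *v x) \<le> y \<bullet> (V *v y)"
    by auto
  have "0 < x \<bullet> (V *v x)" using x(1) by (intro spd_inner_pos[OF assms]) auto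
  moreover have "x \<bullet> (V *v x) * (v \<bullet> v) \<le> v \<bullet> (V *v v)" for v
  proof (cases "v = 0")
    case False
    have "x \<bullet> (V *v x) \<le> (v /\<^sub>R norm v) \<bullet> (V *v (v /\<^sub>R norm v))"
      using False by (intro x(2)) simp
    also have "\<dots> = (v \<bullet> (V *v v)) / (v \<bullet> v)"
      by (simp add: matrix_vector_mult_scaleR dot_square_norm power2_eq_square field_simps)
    finally show ?thesis using False by (simp add: field_simps)
  qed simp
  ultimately show ?thesis by (rule that)
qed

text \<open>The next vector maximises the Rayleigh quotient of \<^term>\<open>H\<close> on the
  \<^term>\<open>G\<close>-orthogonal complement of the vectors found so far.\<close>

lemma simultaneous_diagonalization_step:
  fixes G H :: "real^'p^'p"
  assumes G: "sym_pos_def G" and H: "transpose H = H"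
    and B: "form_orthonormal G B" and card: "card B < CARD('p)"
    and eig: "\<And>b. b \<in> B \<Longrightarrow> H *v b = \<mu> b *\<^sub>R (G *v b)"
  obtains v l where "v \<notin> B" "form_orthonormal G (insert v B)" "H *v v = l *\<^sub>R (G *v v)"
proof -
  have fin: "finite B" using B by (simp add: form_orthonormal_def)
  note symG = inner_sym_matrix[OF spd_sym[OF G]] and symH = inner_sym_matrix[OF H]
  define S where "S = {x. \<forall>b\<in>B. x \<bullet> (G *v b) = 0}"
  have subS: "a *\<^sub>R x + c *\<^sub>R y \<in> S" if "x \<in> S" "y \<in> S" for x y a c
    using that by (auto simp: S_def inner_add_left)
  have clS: "closed S"
    unfolding S_def Ball_def
    by (intro closed_Collect_all closed_Collect_imp closed_Collect_eq continuous_intros) simp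
  \<comment> \<open>\<open>S\<close> is the Euclidean orthogonal complement of the vectors
    \<open>G *v b\<close>. These are fewer than the dimension, so \<open>S\<close> contains a
    nonzero vector.\<close>
  have "dim ((*v) G ` B) \<le> card ((*v) G ` B)"
    using fin by (intro dim_le_card') auto
  also have "\<dots> \<le> card B" by (intro card_image_le fin)
  finally have "dim ((*v) G ` B) < DIM(real^'p)" using card by simp
  from orthogonal_to_subspace_exists[OF this] obtain x0
    where x0: "x0 \<noteq> 0" "\<And>y. y \<in> span ((*v) G ` B) \<Longrightarrow> orthogonal x0 y" by metis
  have x0S: "x0 \<in> S" using x0(2) by (auto simp: S_def orthogonal_def span_base)
  define E where "E = S \<inter> {x. x \<bullet> (G *v x) = 1}"
  have scale: "(1 / sqrt (x \<bullet> (G *v x))) *\<^sub>R x \<in> E" if "x \<in> S" "x \<noteq> 0" for x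
    using subS[OF that(1) that(1), of "1 / sqrt (x \<bullet> (G *v x))" 0] spd_inner_pos[OF G that(2)]
    by (auto simp: E_def matrix_vector_mult_scaleR field_simps)
  have "closed E"
    unfolding E_def by (intro closed_Int clS closed_Collect_eq continuous_intros)
  moreover have "bounded E"
  proof -
    obtain c where c: "0 < c" "\<And>v. c * (v \<bullet> v) \<le> v \<bullet> (G *v v)"
      by (rule sym_pos_def_lower_bound[OF G]) blast
    have "norm x \<le> sqrt (1 / c)" if "x \<in> E" for x
    proof -
      have "c * (x \<bullet> x) \<le> 1" using c(2)[of x] that by (simp add: E_def)
      then show ?thesis using c(1) by (intro real_le_rsqrt) (simp add: power2_norm_eq_inner field_simps)
    qed
    then show ?thesis by (auto simp: bounded_iff)
  qed
  ultimately have cE: "compact E" by (simp add: compact_eq_bounded_closed)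
  have neE: "E \<noteq> {}" using scale[OF x0S x0(1)] by auto
  have "continuous_on E (\<lambda>x. x \<bullet> (H *v x))" by (intro continuous_intros)
  from continuous_attains_sup[OF cE neE this] obtain v
    where v: "v \<in> E" "\<And>y. y \<in> E \<Longrightarrow> y \<bullet> (H *v y) \<le> v \<bullet> (H *v v)" by auto
  define l where "l = v \<bullet> (H *v v)"
  have vS: "v \<in> S" and vv: "v \<bullet> (G *v v) = 1" using v(1) by (auto simp: E_def)
  have le: "x \<bullet> (H *v x) \<le> l * (x \<bullet> (G *v x))" if "x \<in> S" for x
  proof (cases "x = 0")
    case False
    have "x \<bullet> (H *v x) / (x \<bullet> (G *v x)) \<le> l"
      using v(2)[OF scale[OF that False]] spd_inner_pos[OF G False]
      by (simp add: l_def matrix_vector_mult_scaleR)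
    then show ?thesis using spd_inner_pos[OF G False] by (simp add: field_simps)
  qed simp
  \<comment> \<open>Along \<open>v + s *\<^sub>R w\<close> the difference between the two sides of
    \<open>le\<close> is non-negative and vanishes at \<open>s = 0\<close>, so its linear term is
    zero.\<close>
  have onS: "w \<bullet> (H *v v) = l * (w \<bullet> (G *v v))" if w: "w \<in> S" for w
  proof -
    have "l * (w \<bullet> (G *v v)) - w \<bullet> (H *v v) = 0"
    proof (rule linear_coefficient_zero)
      fix s
      have "v + s *\<^sub>R w \<in> S" using subS[OF vS w, of 1 s] by simp
      from le[OF this] show "0 \<le> 2 * s * (l * (w \<bullet> (G *v v)) - w \<bullet> (H *v v))
          + s\<^sup>2 * (l * (w \<bullet> (G *v w)) - w \<bullet> (H *v w))"
        using vv symG[of v w] symH[of v w]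
        by (simp add: matrix_vector_right_distrib matrix_vector_mult_scaleR inner_add_left
            inner_add_right power2_eq_square algebra_simps flip: l_def)
    qed
    then show ?thesis by simp
  qed
  have onB: "b \<bullet> (H *v v) = l * (b \<bullet> (G *v v))" if "b \<in> B" for b
    using vS that by (simp add: S_def symH[of b v] symG[of b v] eig)
  \<comment> \<open>Split \<open>x\<close> into its \<open>G\<close>-orthogonal projection
    \<open>y\<close> onto the span of \<open>B\<close> and a remainder in \<open>S\<close>; the
    eigenvector equation has been tested on both kinds of vector.\<close>
  have "x \<bullet> (H *v v) = x \<bullet> (l *\<^sub>R (G *v v))" for x
  proof -
    define y where "y = (\<Sum>b\<in>B. (b \<bullet> (G *v x)) *\<^sub>R b)"
    have "x - y \<in> S"
    proof -
      have "(x - y) \<bullet> (G *v b) = 0" if "b \<in> B" for b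
        using form_orthonormal_inner_sum[OF B that, of "\<lambda>b. b \<bullet> (G *v x)"]
        by (subst symG) (simp add: matrix_vector_mult_diff_distrib inner_diff_right y_def)
      then show ?thesis by (simp add: S_def)
    qed
    moreover have "y \<bullet> (H *v v) = l * (y \<bullet> (G *v v))"
      by (simp add: y_def inner_sum_left onB sum_distrib_left algebra_simps)
    ultimately show ?thesis using onS[of "x - y"] by (simp add: inner_diff_left algebra_simps)
  qed
  then have Hv: "H *v v = l *\<^sub>R (G *v v)" by (metis (no_types) inner_eq_span_UNIV span_UNIV)
  have vB: "v \<notin> B" using vS vv by (auto simp: S_def)
  have "b \<bullet> (G *v v) = 0" if "b \<in> B" for b
    using vS that by (simp add: symG[of b v] S_def)
  then have "form_orthonormal G (insert v B)"
    using B vS vv vB by (auto simp: form_orthonormal_def S_def)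
  from that[OF vB this Hv] show ?thesis .
qed

lemma simultaneous_diagonalization:
  fixes G H :: "real^'p^'p"
  assumes G: "sym_pos_def G" and H: "transpose H = H"
  obtains B \<mu> where "form_orthonormal G B" "card B = CARD('p)"
    "\<And>b. b \<in> B \<Longrightarrow> H *v b = \<mu> b *\<^sub>R (G *v b)"
proof -
  have "\<exists>B \<mu>. form_orthonormal G B \<and> card B = k \<and> (\<forall>b\<in>B. H *v b = \<mu> b *\<^sub>R (G *v b))"
    if "k \<le> CARD('p)" for k
    using that
  proof (induction k)
    case 0
    show ?case by (rule exI[of _ "{}"]) (simp add: form_orthonormal_def)
  next
    case (Suc k)
    then obtain B \<mu> where *: "form_orthonormal G B" "card B = k"
        "\<And>b. b \<in> B \<Longrightarrow> H *v b = \<mu> b *\<^sub>R (G *v b)" by auto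
    have "card B < CARD('p)" using *(2) Suc.prems by simp
    from simultaneous_diagonalization_step[OF G H *(1) this *(3)] obtain v l
      where v: "v \<notin> B" "form_orthonormal G (insert v B)" "H *v v = l *\<^sub>R (G *v v)" by blast
    have "finite B" using *(1) by (simp add: form_orthonormal_def)
    then show ?case
      using v *(2,3) by (intro exI[of _ "insert v B"] exI[of _ "\<mu>(v := l)"]) auto
  qed
  from this[of "CARD('p)"] that show ?thesis by auto
qed

section \<open>Multisets in general position\<close>

lemma sum_mset_eq_pointwise:
  fixes f g :: "'a \<Rightarrow> real"
  assumes "\<And>z. z \<in># Z \<Longrightarrow> f z \<le> g z" "(\<Sum>z\<in>#Z. g z) \<le> (\<Sum>z\<in>#Z. f z)" "z \<in># Z"
  shows "f z = g z"
proof -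
  obtain Z' where Z: "Z = add_mset z Z'" using assms(3) by (meson multi_member_split)
  have "(\<Sum>z\<in>#Z'. f z) \<le> (\<Sum>z\<in>#Z'. g z)"
    by (rule sum_mset_mono) (use assms(1) Z in auto)
  then show ?thesis using assms(1)[OF assms(3)] assms(2) Z by simp
qed

lemma sum_mset_filter_const:
  "(\<Sum>z\<in>#Z. if P z then c else 0) = c * real (size (filter_mset P Z))"
  by (induction Z) (auto simp: algebra_simps)

lemma sum_sum_mset:
  fixes f :: "'a \<Rightarrow> 'b \<Rightarrow> real"
  shows "(\<Sum>b\<in>B. \<Sum>z\<in>#Z. f b z) = (\<Sum>z\<in>#Z. \<Sum>b\<in>B. f b z)"
  by (induction Z) (auto simp: sum.distrib)

lemma size_filter_not: "size (filter_mset P Z) + size (filter_mset (\<lambda>z. \<not> P z) Z) = size Z"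
  by (induction Z) auto

lemma size_filter_mset_mono:
  "(\<And>z. z \<in># Z \<Longrightarrow> P z \<Longrightarrow> Q z) \<Longrightarrow> size (filter_mset P Z) \<le> size (filter_mset Q Z)"
  by (induction Z) auto

lemma card_set_mset_le_size: "card (set_mset M) \<le> size M"
  by (induction M) (auto intro: le_trans[OF card_insert_le_m1] simp: card_insert_if)

lemma obtain_submset_size:
  assumes "n \<le> size M"
  obtains N where "N \<subseteq># M" "size N = n"
proof -
  obtain xs where xs: "M = mset xs" by (metis ex_mset)
  have "mset (take n xs) \<subseteq># mset xs"
    by (metis append_take_drop_id mset_append mset_subset_eq_add_left)
  with that[of "mset (take n xs)"] assms xs show ?thesis by simp
qed

text \<open>Independence survives small perturbations, uniformly in the subspace. Replacing the
  vectors of \<open>S\<close> by nearby points of \<open>T\<close> extends to a linear map whose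
  distance from the identity is less than 1 in operator norm, hence to an injective map.\<close>

lemma independent_near_subspace:
  fixes D :: "'a::euclidean_space set"
  assumes D: "independent D" "span D = UNIV"
  shows "\<exists>e>0. \<forall>S T. S \<subseteq> D \<longrightarrow> subspace T \<longrightarrow> (\<forall>x\<in>S. \<exists>y\<in>T. norm (x - y) < e) \<longrightarrow> card S \<le> dim T"
proof -
  have fin: "finite D" using D(1) by (rule independent_imp_finite)
  have lin: "linear (\<lambda>v. representation D v b)" for b
    using D by (intro linearI) (auto simp: representation_add representation_scale)
  have "\<exists>C. 0 < C \<and> (\<forall>v. norm (representation D v b) \<le> C * norm v)" for b
    using linear_bounded_pos[OF lin[of b]] by metis
  then obtain C where C: "\<And>b. 0 < C b" "\<And>b v. \<bar>representation D v b\<bar> \<le> C b * norm v"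
    by (metis real_norm_def)
  \<comment> \<open>\<open>C b\<close> bounds the coordinate functional of \<open>b\<close>, so
    moving each basis vector by at most \<open>e\<close> moves \<open>v\<close> by less than
    \<open>norm v\<close>.\<close>
  define e where "e = 1 / ((\<Sum>b\<in>D. C b) + 1)"
  have Cpos: "0 \<le> (\<Sum>b\<in>D. C b)" using C(1) by (simp add: sum_nonneg less_imp_le)
  have e: "0 < e" "e * (\<Sum>b\<in>D. C b) < 1"
    using Cpos by (simp_all add: e_def field_simps)
  have "card S \<le> dim T"
    if S: "S \<subseteq> D" and T: "subspace T" and near: "\<forall>x\<in>S. \<exists>y\<in>T. norm (x - y) < e" for S T
  proof -
    from near obtain y where y: "\<And>x. x \<in> S \<Longrightarrow> y x \<in> T \<and> norm (x - y x) < e" by metis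
    obtain h where h: "linear h" "\<And>x. x \<in> D \<Longrightarrow> h x = (if x \<in> S then y x else x)"
      using linear_independent_extend[OF D(1), of "\<lambda>x. if x \<in> S then y x else x"] by blast
    have "h v \<noteq> 0" if "v \<noteq> 0" for v
    proof
      assume hv: "h v = 0"
      have v: "v = (\<Sum>b\<in>D. representation D v b *\<^sub>R b)"
        using sum_representation_eq[OF D(1), of v D] D(2) fin by simp
      have "v - h v = (\<Sum>b\<in>D. representation D v b *\<^sub>R b) - h (\<Sum>b\<in>D. representation D v b *\<^sub>R b)"
        using v by simp
      also have "\<dots> = (\<Sum>b\<in>D. representation D v b *\<^sub>R (b - h b))"
        by (simp add: linear_sum[OF h(1)] linear_scale[OF h(1)] sum_subtractf algebra_simps)
      also have "norm \<dots> \<le> (\<Sum>b\<in>D. C b * norm v * e)"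
      proof (rule sum_norm_le)
        fix b assume "b \<in> D"
        then have "norm (b - h b) \<le> e" using y h(2) e(1) by (auto intro: less_imp_le)
        then show "norm (representation D v b *\<^sub>R (b - h b)) \<le> C b * norm v * e"
          unfolding norm_scaleR using C(1)[of b]
          by (intro mult_mono C(2)) (simp_all add: less_imp_le)
      qed
      also have "\<dots> = (e * (\<Sum>b\<in>D. C b)) * norm v"
        by (simp add: sum_distrib_left sum_distrib_right algebra_simps)
      also have "\<dots> < 1 * norm v" using e(2) that by (intro mult_strict_right_mono) auto
      finally show False using hv by simp
    qed
    then have "inj h" using h(1) by (metis linear_injective_0)
    then have "dim (h ` S) = dim S"
      by (intro dim_image_eq h(1)) (auto intro: inj_on_subset)
    also have "dim S = card S"
      using D(1) S by (intro dim_eq_card_independent) (rule independent_mono)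
    moreover have "dim (h ` S) \<le> dim T"
      using S y h(2) by (intro dim_subset) auto
    ultimately show ?thesis by simp
  qed
  with e(1) show ?thesis by blast
qed

text \<open>A quantitative form of general position. The data contain finitely many bases, so the
  smallest of their stability radii serves all of them. If too many points were near
  \<open>T\<close>, some of them could be completed to \<open>p\<close> data points, which form a
  basis, contradicting stability.\<close>

lemma general_position_near_subspace:
  fixes X :: "(real^'p) multiset"
  assumes gp: "\<And>W. W \<subseteq># X \<Longrightarrow> size W = CARD('p) \<Longrightarrow> span (set_mset W) = UNIV"
    and size: "CARD('p) \<le> size X"
  obtains e where "0 < e" "\<And>T. subspace T \<Longrightarrow> dim T < CARD('p) \<Longrightarrow>
    size {#x \<in># X. \<exists>y\<in>T. norm (x - y) < e#} \<le> dim T"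
proof -
  define F where "F = {D. D \<subseteq> set_mset X \<and> independent D \<and> span D = UNIV}"
  have finF: "finite F" by (rule finite_subset[of _ "Pow (set_mset X)"]) (auto simp: F_def)
  have "\<forall>D\<in>F. \<exists>e>0. \<forall>S T. S \<subseteq> D \<longrightarrow> subspace T \<longrightarrow> (\<forall>x\<in>S. \<exists>y\<in>T. norm (x - y) < e) \<longrightarrow> card S \<le> dim T"
    using independent_near_subspace by (auto simp: F_def)
  then obtain e where e: "\<And>D. D \<in> F \<Longrightarrow> 0 < e D"
    "\<And>D S T. D \<in> F \<Longrightarrow> S \<subseteq> D \<Longrightarrow> subspace T \<Longrightarrow> \<forall>x\<in>S. \<exists>y\<in>T. norm (x - y) < e D \<Longrightarrow> card S \<le> dim T"
    by metis
  define e0 where "e0 = Min (insert 1 (e ` F))"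
  have "0 < e0" using finF e(1) by (simp add: e0_def)
  moreover have "size {#x \<in># X. \<exists>y\<in>T. norm (x - y) < e0#} \<le> dim T"
    if T: "subspace T" "dim T < CARD('p)" for T
  proof (rule ccontr)
    let ?N = "{#x \<in># X. \<exists>y\<in>T. norm (x - y) < e0#}"
    assume "\<not> size ?N \<le> dim T"
    then have "Suc (dim T) \<le> size ?N" by simp
    then obtain S where S: "S \<subseteq># ?N" "size S = Suc (dim T)" by (rule obtain_submset_size)
    have SX: "S \<subseteq># X" using S(1) by (meson multiset_filter_subset subset_mset.order_trans)
    then have "CARD('p) - Suc (dim T) \<le> size (X - S)" using size S(2) by (simp add: size_Diff_submset)
    then obtain R where R: "R \<subseteq># X - S" "size R = CARD('p) - Suc (dim T)"
      by (rule obtain_submset_size)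
    have "S + R \<subseteq># X" using R(1) SX
      by (metis subset_mset.add_left_mono subset_mset.add_diff_inverse)
    moreover have sz: "size (S + R) = CARD('p)" using S(2) R(2) T(2) by simp
    ultimately have sp: "span (set_mset (S + R)) = UNIV" by (rule gp)
    \<comment> \<open>A spanning multiset of exactly \<open>p\<close> points has no repetitions, so
      passing from \<open>S\<close> and \<open>R\<close> to their sets loses no points.\<close>
    have "dim (UNIV :: (real^'p) set) \<le> card (set_mset (S + R))"
      by (rule dim_le_card) (use sp in auto)
    then have cge: "CARD('p) \<le> card (set_mset (S + R))" by simp
    moreover have "card (set_mset (S + R)) \<le> card (set_mset S) + card (set_mset R)"
      by (simp add: card_Un_le)
    ultimately have cS: "Suc (dim T) \<le> card (set_mset S)"
      using card_set_mset_le_size[of R] R(2) T(2) by simp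
    have "independent (set_mset (S + R))"
    proof (rule card_le_dim_spanning[of _ UNIV])
      show "card (set_mset (S + R)) \<le> dim (UNIV :: (real^'p) set)"
        using card_set_mset_le_size[of "S + R"] sz by simp
    qed (use sp in auto)
    then have mem: "set_mset (S + R) \<in> F"
      using sp \<open>S + R \<subseteq># X\<close> set_mset_mono[of "S + R" X] by (simp add: F_def)
    have "e0 \<le> e (set_mset (S + R))" using mem finF by (simp add: e0_def)
    moreover have "\<forall>x\<in>set_mset S. \<exists>y\<in>T. norm (x - y) < e0"
      using set_mset_mono[OF S(1)] by auto
    ultimately have "\<forall>x\<in>set_mset S. \<exists>y\<in>T. norm (x - y) < e (set_mset (S + R))"
      by (meson less_le_trans)
    from e(2)[OF mem _ T(1) this] cS show False by simp
  qed
  ultimately show ?thesis by (rule that)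
qed

text \<open>This is the case \<open>T = {0}\<close>. It ensures that the weights of data points are
  taken at positive arguments, where the conditions on \<open>u\<close> hold.\<close>

lemma general_position_nonzero:
  fixes X :: "(real^'p) multiset"
  assumes gp: "\<And>W. W \<subseteq># X \<Longrightarrow> size W = CARD('p) \<Longrightarrow> span (set_mset W) = UNIV"
    and size: "CARD('p) \<le> size X"
  shows "0 \<notin># X"
proof -
  obtain e where e: "0 < e" "\<And>T. subspace T \<Longrightarrow> dim T < CARD('p) \<Longrightarrow>
      size {#x \<in># X. \<exists>y\<in>T. norm (x - y) < e#} \<le> dim T"
    by (rule general_position_near_subspace[OF gp size]) auto
  have "size {#x \<in># X. \<exists>y\<in>{0}. norm (x - y) < e#} \<le> 0"
    using e(2)[OF subspace_single_0] by simp
  then have "{#x \<in># X. \<exists>y\<in>{0}. norm (x - y) < e#} = {#}" by simp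
  then have "0 \<notin># {#x \<in># X. \<exists>y\<in>{0}. norm (x - y) < e#}" by (simp only: set_mset_empty empty_iff not_False_eq_True)
  then show ?thesis using e(1) by simp
qed

section \<open>Weight functions and supersolutions\<close>

lemma weight_nonneg: "weight_function u \<Longrightarrow> 0 < s \<Longrightarrow> 0 \<le> u s"
  unfolding weight_function_def by blast

lemma weight_antimono:
  assumes "weight_function u" "0 < s" "s \<le> s'"
  shows "u s' \<le> u s"
proof -
  have "antimono_on {0<..} u" using assms(1) unfolding weight_function_def by blast
  from monotone_onD[OF this, of s s'] assms(2,3) show ?thesis by simp
qed

lemma weight_bounded:
  assumes "weight_function u"
  obtains M where "0 < M" "\<And>s. 0 < s \<Longrightarrow> u s \<le> M"
proof -
  have "bounded (u ` {0..})" using assms unfolding weight_function_def by blast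
  then obtain M where M: "0 < M" "\<forall>x\<in>u ` {0..}. norm x \<le> M" unfolding bounded_pos by blast
  have "u s \<le> M" if "0 < s" for s
  proof -
    have "norm (u s) \<le> M" using M(2) that by simp
    then show ?thesis by simp
  qed
  with M(1) that show ?thesis by blast
qed

lemma psi_le_sup:
  assumes "weight_function u" "0 < s"
  shows "psi u s \<le> psi_sup u"
proof -
  have "bounded (psi u ` {0<..})"
    using assms(1) unfolding weight_function_def
    by (auto intro: bounded_subset[of "psi u ` {0..}"])
  then show ?thesis
    unfolding psi_sup_def using assms(2) by (intro cSUP_upper bounded_imp_bdd_above) auto
qed

lemma psi_mono:
  assumes "weight_function u" "0 < s" "s \<le> s'"
  shows "psi u s \<le> psi u s'"
proof -
  have "mono_on {0<..} (psi u)" using assms(1) unfolding weight_function_def by blast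
  from monotone_onD[OF this, of s s'] assms(2,3) show ?thesis by simp
qed

text \<open>Strict monotonicity below the supremum allows \<open>psi\<close> to be flat only at its
  top value.\<close>

lemma psi_saturated:
  assumes "weight_function u" "0 < s" "s < s'" "psi u s = psi u s'"
  shows "psi u s = psi_sup u"
proof (rule ccontr)
  assume "psi u s \<noteq> psi_sup u"
  then have lt: "psi u s < psi_sup u" using psi_le_sup[OF assms(1,2)] by simp
  have "strict_mono_on {s. 0 < s \<and> psi u s < psi_sup u} (psi u)"
    using assms(1) unfolding weight_function_def by blast
  from strict_mono_onD[OF this, of s s'] lt assms(2-4) show False by simp
qed

lemma psi_tendsto_sup:
  assumes "weight_function u"
  shows "(psi u \<longlongrightarrow> psi_sup u) at_top"
proof (rule order_tendstoI)
  fix a assume "a < psi_sup u"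
  then obtain s where s: "0 < s" "a < psi u s"
    unfolding psi_sup_def by (rule less_cSupE) auto
  show "\<forall>\<^sub>F x in at_top. a < psi u x"
    using eventually_ge_at_top[of s]
    by eventually_elim (use s psi_mono[OF assms s(1)] in \<open>auto intro: less_le_trans\<close>)
next
  fix a assume a: "psi_sup u < a"
  show "\<forall>\<^sub>F x in at_top. psi u x < a"
  proof (rule eventually_mono[OF eventually_gt_at_top[of 0]])
    fix x :: real assume "0 < x"
    from psi_le_sup[OF assms this] show "psi u x < a" using a by simp
  qed
qed

text \<open>The quadratic form of the right side of the defining equation, for points already
  translated so that the centre is 0. If it is at most \<open>v \<bullet> (V *v v)\<close> for all
  \<open>v\<close>, then \<open>V\<close> is a supersolution of that equation in the Loewner
  order.\<close>

definition weighted_form :: "(real \<Rightarrow> real) \<Rightarrow> (real^'p) multiset \<Rightarrow> real^'p^'p \<Rightarrow> real^'p \<Rightarrow> real" where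
  "weighted_form u Z V v =
     (\<Sum>z\<in>#Z. u (z \<bullet> (matrix_inv V *v z)) * (z \<bullet> v)\<^sup>2) / real (size Z)"

section \<open>Eigenbasis expansions, spectral gaps and the lower bound for supersolutions\<close>

lemma form_orthonormal_expand:
  fixes B :: "(real^'p) set"
  assumes G: "sym_pos_def G" and B: "form_orthonormal G B" "card B = CARD('p)"
  shows "x = (\<Sum>b\<in>B. (b \<bullet> (G *v x)) *\<^sub>R b)" (is "x = ?y")
proof -
  have "G *v x = G *v ?y"
    by (rule inner_eq_span_UNIV[OF form_orthonormal_span[OF B]])
      (simp add: form_orthonormal_inner_sum[OF B(1)])
  then show ?thesis by (metis spd_mult_inv(2)[OF G])
qed

lemma form_orthonormal_norm_sum:
  assumes B: "form_orthonormal (mat 1) B" "A \<subseteq> B"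
  shows "(norm (\<Sum>b\<in>A. f b *\<^sub>R b))\<^sup>2 = (\<Sum>b\<in>A. (f b)\<^sup>2)"
proof -
  have A: "form_orthonormal (mat 1) A"
    using B finite_subset unfolding form_orthonormal_def by blast
  show ?thesis
    using form_orthonormal_inner_sum[OF A, of _ f]
    unfolding power2_norm_eq_inner inner_sum_left by (simp add: power2_eq_square)
qed

text \<open>Pigeonhole: the \<open>card B\<close> disjoint intervals from
  \<open>\<tau> ^ (k + 1)\<close> to \<open>\<tau> ^ k\<close> lie above \<open>\<mu> b0\<close>,
  and only \<open>card B - 1\<close> other eigenvalues can occupy them, so one interval is
  empty.\<close>

lemma eigenvalue_gap:
  fixes \<mu> :: "'a \<Rightarrow> real"
  assumes "finite B" "b0 \<in> B" "\<mu> b0 < \<tau> ^ (card B + 1)" and \<tau>: "0 < \<tau>" "\<tau> < 1"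
  obtains (gap) k where "1 \<le> k" "\<mu> b0 < \<tau> ^ (k + 1)"
    "\<And>b. b \<in> B \<Longrightarrow> \<mu> b < \<tau> ^ (k + 1) \<or> \<tau> ^ k \<le> \<mu> b"
proof (rule ccontr)
  have small: "\<mu> b0 < \<tau> ^ (k + 1)" if "k \<le> card B" for k
  proof -
    have "\<tau> ^ (card B + 1) \<le> \<tau> ^ (k + 1)" using \<tau> that by (intro power_decreasing) auto
    with assms(3) show ?thesis by linarith
  qed
  assume no_gap: "\<not> thesis"
  have "\<exists>b\<in>B. \<tau> ^ (k + 1) \<le> \<mu> b \<and> \<mu> b < \<tau> ^ k" if k: "k \<in> {1..card B}" for k
  proof (rule ccontr)
    assume "\<not> (\<exists>b\<in>B. \<tau> ^ (k + 1) \<le> \<mu> b \<and> \<mu> b < \<tau> ^ k)"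
    then have "\<mu> b < \<tau> ^ (k + 1) \<or> \<tau> ^ k \<le> \<mu> b" if "b \<in> B" for b
      using that by (meson not_less)
    with gap[of k] no_gap small[of k] k show False by auto
  qed
  then obtain g where g: "\<And>k. k \<in> {1..card B} \<Longrightarrow> g k \<in> B \<and> \<tau> ^ (k + 1) \<le> \<mu> (g k) \<and> \<mu> (g k) < \<tau> ^ k"
    by metis
  have ne: "g j \<noteq> g k" if "j \<in> {1..card B}" "k \<in> {1..card B}" "j < k" for j k
  proof -
    have "\<tau> ^ k \<le> \<tau> ^ (j + 1)" using \<tau> that(3) by (intro power_decreasing) auto
    then have "\<mu> (g k) < \<mu> (g j)" using g[OF that(1)] g[OF that(2)] by linarith
    then show ?thesis by auto
  qed
  have "inj_on g {1..card B}"
    using ne by (intro linorder_inj_onI) auto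
  moreover have "g k \<noteq> b0" if "k \<in> {1..card B}" for k
    using g[OF that] small[of k] that by auto
  then have "g ` {1..card B} \<subseteq> B - {b0}" using g by blast
  ultimately have "card {1..card B} \<le> card (B - {b0})"
    using assms(1) by (intro card_inj_on_le) auto
  moreover have "0 < card B" using assms(1,2) by (auto simp: card_gt_0_iff)
  ultimately show False using assms(1,2) by simp
qed

text \<open>The points singled out by \<^term>\<open>P\<close> are far from the span of the large eigenvectors,
  so nearly all of their weight falls on the span of the small eigenvectors \<^term>\<open>A\<close>,
  where it must not exceed the trace of the corresponding projection.\<close>

lemma supersolution_gap_inequality:
  fixes V :: "real^'p^'p" and Z :: "(real^'p) multiset"
  assumes u: "weight_function u" and V: "sym_pos_def V"
    and super: "\<And>v. weighted_form u Z V v \<le> v \<bullet> (V *v v)" and Z0: "0 \<notin># Z"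
    and B: "form_orthonormal (mat 1) B" "card B = CARD('p)"
    and eig: "\<And>b. b \<in> B \<Longrightarrow> V *v b = \<mu> b *\<^sub>R b"
    and A: "A \<subseteq> B" "\<And>b. b \<in> A \<Longrightarrow> \<mu> b \<le> l * \<tau>" "\<And>b. b \<in> B - A \<Longrightarrow> l \<le> \<mu> b"
    and l: "0 < l" "l \<le> 1" and \<tau>: "0 < \<tau>" and h: "0 < h" and R: "0 \<le> R"
    and P: "\<And>z. z \<in># Z \<Longrightarrow> P z \<Longrightarrow> h \<le> (\<Sum>b\<in>A. (z \<bullet> b)\<^sup>2) \<and> (\<Sum>b\<in>B - A. (z \<bullet> b)\<^sup>2) \<le> R"
  shows "psi u (h / \<tau>) * (h / (h + R * \<tau>)) * real (size (filter_mset P Z))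
    \<le> real (size Z) * real (card A)"
proof -
  have finB: "finite B" using B(1) by (simp add: form_orthonormal_def)
  then have finA: "finite A" using A(1) finite_subset by blast
  have eig': "V *v b = \<mu> b *\<^sub>R (mat 1 *v b)" if "b \<in> B" for b using eig[OF that] by simp
  have pos: "0 < \<mu> b" if "b \<in> B" for b
    using form_orthonormal_inv(1)[OF B V, of \<mu> b] eig' that by blast
  have inv: "z \<bullet> (matrix_inv V *v z) = (\<Sum>b\<in>B. (z \<bullet> b)\<^sup>2 / \<mu> b)" for z
    using form_orthonormal_inv(2)[OF B V, of \<mu> z] eig' by blast
  define s where "s z = z \<bullet> (matrix_inv V *v z)" for z
  define sA where "sA z = (\<Sum>b\<in>A. (z \<bullet> b)\<^sup>2 / \<mu> b)" for z
  have spos: "0 < s z" if "z \<in># Z" for z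
    using spd_inv_form_pos[OF V, of z] that Z0 by (auto simp: s_def)
  have sA0: "0 \<le> sA z" for z
    using A(1) pos by (auto simp: sA_def intro!: sum_nonneg divide_nonneg_pos)
  \<comment> \<open>\<open>sA z / s z\<close> is the share of \<open>s z\<close> carried by
    \<open>A\<close>. It is close to 1 for small \<open>\<tau>\<close>, while
    \<open>psi u (s z)\<close> is close to its supremum.\<close>
  have bound: "psi u (h / \<tau>) * (h / (h + R * \<tau>)) \<le> u (s z) * sA z" if z: "z \<in># Z" "P z" for z
  proof -
    define sR where "sR = (\<Sum>b\<in>B - A. (z \<bullet> b)\<^sup>2 / \<mu> b)"
    have s: "s z = sA z + sR"
      using sum.subset_diff[OF A(1) finB, of "\<lambda>b. (z \<bullet> b)\<^sup>2 / \<mu> b"]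
      by (simp add: s_def inv sA_def sR_def)
    have "h / (l * \<tau>) \<le> (\<Sum>b\<in>A. (z \<bullet> b)\<^sup>2) / (l * \<tau>)"
      using P[OF z] l \<tau> by (intro divide_right_mono) auto
    also have "\<dots> \<le> sA z"
      unfolding sA_def sum_divide_distrib using A pos l \<tau>
      by (intro sum_mono divide_left_mono) auto
    finally have a: "h / (l * \<tau>) \<le> sA z" .
    have "sR \<le> (\<Sum>b\<in>B - A. (z \<bullet> b)\<^sup>2) / l"
      unfolding sR_def sum_divide_distrib using A pos l
      by (intro sum_mono divide_left_mono) auto
    also have "\<dots> \<le> R / l" using P[OF z] l by (intro divide_right_mono) auto
    finally have c: "sR \<le> R / l" .
    have sR0: "0 \<le> sR" using pos by (auto simp: sR_def intro!: sum_nonneg divide_nonneg_pos)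
    \<comment> \<open>Here \<open>l \<le> 1\<close> makes the estimate independent of the level at
      which the gap occurs.\<close>
    have "h / \<tau> \<le> h / (l * \<tau>)" using l \<tau> h by (intro divide_left_mono) auto
    then have "h / \<tau> \<le> s z" using a s sR0 by linarith
    then have psi: "psi u (h / \<tau>) \<le> psi u (s z)" using h \<tau> by (intro psi_mono[OF u]) auto
    have "h * sR \<le> h * (R / l)" using c h by (intro mult_left_mono) auto
    also have "\<dots> = R * \<tau> * (h / (l * \<tau>))" using \<tau> by simp
    also have "\<dots> \<le> R * \<tau> * sA z" using a R \<tau> by (intro mult_left_mono) auto
    finally have "h * s z \<le> (h + R * \<tau>) * sA z" by (simp add: s algebra_simps)
    moreover have "0 < h + R * \<tau>" using h R \<tau> by (intro add_pos_nonneg) auto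
    ultimately have "h / (h + R * \<tau>) \<le> sA z / s z"
      using spos[OF z(1)] by (simp add: field_simps)
    moreover have "0 \<le> psi u (s z)"
      using weight_nonneg[OF u spos[OF z(1)]] spos[OF z(1)] by (simp add: psi_def)
    ultimately have "psi u (h / \<tau>) * (h / (h + R * \<tau>)) \<le> psi u (s z) * (sA z / s z)"
      using psi h \<open>0 < h + R * \<tau>\<close> by (intro mult_mono) auto
    also have "\<dots> = u (s z) * sA z" using spos[OF z(1)] by (simp add: psi_def)
    finally show ?thesis .
  qed
  have "psi u (h / \<tau>) * (h / (h + R * \<tau>)) * real (size (filter_mset P Z))
      = (\<Sum>z\<in>#Z. if P z then psi u (h / \<tau>) * (h / (h + R * \<tau>)) else 0)"
    by (simp add: sum_mset_filter_const)
  also have "\<dots> \<le> (\<Sum>z\<in>#Z. u (s z) * sA z)"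
    using bound weight_nonneg[OF u spos] sA0 by (intro sum_mset_mono) auto
  also have "\<dots> = (\<Sum>z\<in>#Z. \<Sum>b\<in>A. u (s z) * (z \<bullet> b)\<^sup>2 / \<mu> b)"
    by (simp add: sA_def sum_distrib_left)
  also have "\<dots> = (\<Sum>b\<in>A. \<Sum>z\<in>#Z. u (s z) * (z \<bullet> b)\<^sup>2 / \<mu> b)"
    by (simp add: sum_sum_mset)
  \<comment> \<open>Testing the supersolution inequality on a unit eigenvector and dividing by its
    eigenvalue costs at most \<open>size Z\<close> for each direction in \<open>A\<close>.\<close>
  also have "\<dots> \<le> (\<Sum>b\<in>A. real (size Z))"
  proof (rule sum_mono)
    fix b assume "b \<in> A"
    then have b: "b \<in> B" using A(1) by auto
    have bb: "b \<bullet> b = 1" using B(1) b by (auto simp: form_orthonormal_def)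
    have "(\<Sum>z\<in>#Z. u (s z) * (z \<bullet> b)\<^sup>2) / real (size Z) \<le> \<mu> b"
      using super[of b] eig[OF b] bb by (simp add: weighted_form_def s_def)
    then have "(\<Sum>z\<in>#Z. u (s z) * (z \<bullet> b)\<^sup>2) \<le> \<mu> b * real (size Z)"
      by (cases "Z = {#}") (simp_all add: pos_divide_le_eq nonempty_has_size)
    then have "(\<Sum>z\<in>#Z. u (s z) * (z \<bullet> b)\<^sup>2) / \<mu> b \<le> real (size Z)"
      using pos[OF b] by (simp add: field_simps)
    moreover have "(\<Sum>z\<in>#Z. u (s z) * (z \<bullet> b)\<^sup>2 / \<mu> b) = (\<Sum>z\<in>#Z. u (s z) * (z \<bullet> b)\<^sup>2) / \<mu> b"
      using sum_mset_distrib_right[of "\<lambda>z. u (s z) * (z \<bullet> b)\<^sup>2" Z "1 / \<mu> b"] by simp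
    ultimately show "(\<Sum>z\<in>#Z. u (s z) * (z \<bullet> b)\<^sup>2 / \<mu> b) \<le> real (size Z)" by simp
  qed
  finally show ?thesis by (simp add: mult.commute)
qed

text \<open>For small \<open>\<tau>\<close> the gap inequality would contradict \<open>cond\<close>,
  or \<open>K > p\<close> if all eigenvalues are small. So no eigenvalue falls below
  \<open>\<tau> ^ (p + 1)\<close>, and \<open>\<tau>\<close> is fixed before \<open>Y\<close> and
  \<open>V\<close> are chosen.\<close>

lemma supersolution_lower_bound:
  fixes X :: "(real^'p) multiset"
  assumes u: "weight_function u"
    and gp: "\<And>W. W \<subseteq># X \<Longrightarrow> size W = CARD('p) \<Longrightarrow> span (set_mset W) = UNIV"
    and size: "CARD('p) \<le> size X" and r: "0 < r"
    and K: "real CARD('p) < psi_sup u"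
    and cond: "\<And>q. 1 \<le> q \<Longrightarrow> q < CARD('p) \<Longrightarrow>
       real (size X + m) * real q < real (size X + q - CARD('p)) * psi_sup u"
  obtains c where "0 < c" "\<And>Y V v. \<lbrakk>size Y = m; \<And>y. y \<in># Y \<Longrightarrow> r < y \<bullet> y; sym_pos_def V;
     \<And>v. weighted_form u (X + Y) V v \<le> v \<bullet> (V *v v)\<rbrakk> \<Longrightarrow> c * (v \<bullet> v) \<le> v \<bullet> (V *v v)"
proof -
  define N where "N = size X + m"
  define p where "p = CARD('p)"
  obtain e where e: "0 < e" "\<And>T. subspace T \<Longrightarrow> dim T < p \<Longrightarrow>
      size {#x \<in># X. \<exists>y\<in>T. norm (x - y) < e#} \<le> dim T"
    unfolding p_def by (rule general_position_near_subspace[OF gp size]) auto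
  \<comment> \<open>A lower bound for the squared distance of the counted points from the span of
    the large eigenvectors. Contaminating points are only known to have squared norm above
    \<open>r\<close>, which suffices when that span is zero.\<close>
  define h where "h = min (e\<^sup>2) r"
  have h: "0 < h" "h \<le> e\<^sup>2" "h \<le> r" using e r by (auto simp: h_def)
  define R where "R = (\<Sum>x\<in>set_mset X. x \<bullet> x)"
  have R0: "0 \<le> R" by (auto simp: R_def intro: sum_nonneg)
  have R: "x \<bullet> x \<le> R" if "x \<in># X" for x
    unfolding R_def using that by (intro member_le_sum) auto
  define f where "f = (\<lambda>\<tau>. psi u (h / \<tau>) * (h / (h + R * \<tau>)))"
  \<comment> \<open>A lower bound for the number of points usable against \<open>q\<close> small
    eigenvalues. For \<open>q < p\<close> at most \<open>p - q\<close> data points are near the span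
    of the other eigenvectors, and only data points are counted; for \<open>q = p\<close> all
    \<open>N\<close> points count.\<close>
  define good where "good q = (if q < p then size X + q - p else N)" for q
  have "filterlim (\<lambda>\<tau>. h / \<tau>) at_top (at_right 0)"
    unfolding divide_inverse
    by (rule filterlim_tendsto_pos_mult_at_top[OF tendsto_const h(1) filterlim_inverse_at_top_right])
  then have "((\<lambda>\<tau>. psi u (h / \<tau>)) \<longlongrightarrow> psi_sup u) (at_right 0)"
    by (rule filterlim_compose[OF psi_tendsto_sup[OF u]])
  then have "(f \<longlongrightarrow> psi_sup u * (h / (h + R * 0))) (at_right 0)"
    unfolding f_def using h by (intro tendsto_intros) auto
  then have lim: "(f \<longlongrightarrow> psi_sup u) (at_right 0)" using h by simp
  have Npos: "0 < N" using size by (auto simp: N_def intro: less_le_trans[OF zero_less_card_finite])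
  \<comment> \<open>In the limit these are strict inequalities, from \<open>cond\<close> for
    \<open>q < p\<close> and from \<open>K > p\<close> for \<open>q = p\<close>. Being finitely
    many, they hold together for one small \<open>\<tau>\<close>.\<close>
  have "\<forall>\<^sub>F \<tau> in at_right 0. real N * real q < f \<tau> * real (good q)" if q: "q \<in> {1..p}" for q
  proof -
    have "real N * real q < psi_sup u * real (good q)"
      using cond[of q] q K Npos
      by (auto simp: good_def N_def p_def mult.commute)
    moreover have "((\<lambda>\<tau>. f \<tau> * real (good q)) \<longlongrightarrow> psi_sup u * real (good q)) (at_right 0)"
      by (intro tendsto_intros lim)
    ultimately show ?thesis by (simp add: order_tendstoD)
  qed
  then have "\<forall>\<^sub>F \<tau> in at_right 0. \<forall>q\<in>{1..p}. real N * real q < f \<tau> * real (good q)"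
    by (simp add: eventually_ball_finite)
  moreover have "\<forall>\<^sub>F \<tau> in at_right (0::real). \<tau> \<in> {0<..<1}"
    by (rule eventually_at_right_real) simp
  ultimately have "\<forall>\<^sub>F \<tau> in at_right 0. \<tau> \<in> {0<..<1} \<and> (\<forall>q\<in>{1..p}. real N * real q < f \<tau> * real (good q))"
    by eventually_elim auto
  then obtain \<tau> where \<tau>: "0 < \<tau>" "\<tau> < 1"
    "\<And>q. q \<in> {1..p} \<Longrightarrow> real N * real q < f \<tau> * real (good q)"
    using eventually_happens'[OF trivial_limit_at_right_real] by (metis (no_types, lifting) greaterThanLessThan_iff)
  have main: "\<tau> ^ (p + 1) * (v \<bullet> v) \<le> v \<bullet> (V *v v)"
    if Y: "size Y = m" "\<And>y. y \<in># Y \<Longrightarrow> r < y \<bullet> y" and V: "sym_pos_def V"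
      and super: "\<And>v. weighted_form u (X + Y) V v \<le> v \<bullet> (V *v v)" for Y V v
  proof -
    have mat1: "sym_pos_def (mat 1 :: real^'p^'p)" by (simp add: sym_pos_def_def)
    obtain B \<mu> where B: "form_orthonormal (mat 1) B" "card B = CARD('p)"
      and eig': "\<And>b. b \<in> B \<Longrightarrow> V *v b = \<mu> b *\<^sub>R (mat 1 *v b)"
      using simultaneous_diagonalization[OF mat1 spd_sym[OF V]] by metis
    have eig: "V *v b = \<mu> b *\<^sub>R b" if "b \<in> B" for b using eig'[OF that] by simp
    have finB: "finite B" using B(1) by (simp add: form_orthonormal_def)
    have expand: "x = (\<Sum>b\<in>B. (x \<bullet> b) *\<^sub>R b)" for x
      using form_orthonormal_expand[OF mat1 B, of x]
      by (simp only: matrix_vector_mul_lid inner_commute[of _ x])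
    have sq: "x \<bullet> x = (\<Sum>b\<in>B. (x \<bullet> b)\<^sup>2)" for x
      using form_orthonormal_norm_sum[OF B(1) order_refl, of "\<lambda>b. x \<bullet> b"]
      by (simp only: expand[symmetric] power2_norm_eq_inner)
    have large: "\<tau> ^ (p + 1) \<le> \<mu> b" if b: "b \<in> B" for b
    proof (rule ccontr)
      assume "\<not> \<tau> ^ (p + 1) \<le> \<mu> b"
      then have "\<mu> b < \<tau> ^ (card B + 1)" using B(2) by (simp add: p_def)
      from eigenvalue_gap[of B b \<mu> \<tau>, OF finB b this \<tau>(1,2)]
      obtain k where k: "1 \<le> k" "\<mu> b < \<tau> ^ (k + 1)"
        "\<And>b. b \<in> B \<Longrightarrow> \<mu> b < \<tau> ^ (k + 1) \<or> \<tau> ^ k \<le> \<mu> b" by metis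
      define A where "A = {b \<in> B. \<mu> b < \<tau> ^ (k + 1)}"
      have AB: "A \<subseteq> B" by (auto simp: A_def)
      have finA: "finite A" using AB finB finite_subset by blast
      have "b \<in> A" using b k(2) by (simp add: A_def)
      then have "1 \<le> card A" using finA by (metis One_nat_def Suc_leI card_gt_0_iff empty_iff)
      moreover have cardA: "card A \<le> p" using card_mono[OF finB AB] B(2) by (simp add: p_def)
      ultimately have q: "card A \<in> {1..p}" by simp
      define P where "P z \<longleftrightarrow> h \<le> (\<Sum>b\<in>A. (z \<bullet> b)\<^sup>2) \<and> (\<Sum>b\<in>B - A. (z \<bullet> b)\<^sup>2) \<le> R" for z
      have split: "z \<bullet> z = (\<Sum>b\<in>A. (z \<bullet> b)\<^sup>2) + (\<Sum>b\<in>B - A. (z \<bullet> b)\<^sup>2)" for z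
        using sum.subset_diff[OF AB finB, of "\<lambda>b. (z \<bullet> b)\<^sup>2"] sq[of z] by linarith
      have PX: "P x" if "x \<in># X" "\<not> (\<exists>y\<in>span (B - A). norm (x - y) < e)" for x
      proof -
        define y where "y = (\<Sum>b\<in>B - A. (x \<bullet> b) *\<^sub>R b)"
        define w where "w = (\<Sum>b\<in>A. (x \<bullet> b) *\<^sub>R b)"
        have "x = y + w"
          unfolding y_def w_def by (rule trans[OF expand sum.subset_diff[OF AB finB]])
        moreover have "y \<in> span (B - A)"
          unfolding y_def by (intro span_sum span_scale span_base)
        then have "e \<le> norm (x - y)" using that(2) by (meson not_less)
        ultimately have "e\<^sup>2 \<le> (norm w)\<^sup>2" using e(1) by (intro power_mono) auto
        then have "h \<le> (\<Sum>b\<in>A. (x \<bullet> b)\<^sup>2)"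
          using h(2) form_orthonormal_norm_sum[OF B(1) AB, of "\<lambda>b. x \<bullet> b"] by (simp add: w_def)
        moreover have "(\<Sum>b\<in>B - A. (x \<bullet> b)\<^sup>2) \<le> R"
          using split[of x] R[OF that(1)] sum_nonneg[of A "\<lambda>b. (x \<bullet> b)\<^sup>2"] by simp
        ultimately show ?thesis by (simp add: P_def)
      qed
      have indep: "independent (B - A)"
        by (rule independent_mono[OF form_orthonormal_independent[OF B(1)]]) auto
      have dimT: "dim (span (B - A)) = p - card A"
        using indep AB finB finA B(2) by (simp add: dim_eq_card_independent card_Diff_subset p_def)
      have "size {#x \<in># X. \<exists>y\<in>span (B - A). norm (x - y) < e#} \<le> p - card A"
        using e(2)[OF subspace_span, of "B - A"] dimT q by simp
      then have "size X - (p - card A) \<le> size {#x \<in># X. \<not> (\<exists>y\<in>span (B - A). norm (x - y) < e)#}"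
        using size_filter_not[of "\<lambda>x. \<exists>y\<in>span (B - A). norm (x - y) < e" X] by linarith
      also have "\<dots> \<le> size (filter_mset P X)"
        using PX by (intro size_filter_mset_mono)
      finally have goodX: "size X - (p - card A) \<le> size (filter_mset P X)" .
      have "good (card A) \<le> size (filter_mset P (X + Y))"
      proof (cases "card A < p")
        case True
        then show ?thesis using goodX q by (simp add: good_def)
      next
        case False
        then have "A = B" using cardA AB finB B(2) by (intro card_subset_eq) (auto simp: p_def)
        then have "P y" if "y \<in># Y" for y
          using Y(2)[OF that] h(3) R0 split[of y] sq[of y] by (simp add: P_def)
        then have "filter_mset P Y = Y" by (simp add: filter_mset_eq_conv)
        then show ?thesis using goodX False cardA Y(1) by (simp add: good_def N_def)
      qed
      then have "f \<tau> * real (good (card A)) \<le> f \<tau> * real (size (filter_mset P (X + Y)))"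
        using \<tau> h R0 weight_nonneg[OF u, of "h / \<tau>"]
        by (intro mult_left_mono) (auto simp: f_def psi_def intro!: mult_nonneg_nonneg)
      also have "\<dots> \<le> real (size (X + Y)) * real (card A)"
        unfolding f_def
      proof (rule supersolution_gap_inequality[OF u V super _ B eig AB])
        show "0 \<notin># X + Y" using general_position_nonzero[OF gp size] Y(2)[of 0] r by auto
        show "\<mu> b \<le> \<tau> ^ k * \<tau>" if "b \<in> A" for b using that by (simp add: A_def mult.commute)
        show "\<tau> ^ k \<le> \<mu> b" if "b \<in> B - A" for b using that k(3)[of b] by (auto simp: A_def)
        show "\<tau> ^ k \<le> 1" using \<tau> by (simp add: power_le_one)
        show "h \<le> (\<Sum>b\<in>A. (z \<bullet> b)\<^sup>2) \<and> (\<Sum>b\<in>B - A. (z \<bullet> b)\<^sup>2) \<le> R" if "P z" for z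
          using that by (simp add: P_def)
      qed (use \<tau> h R0 in auto)
      finally show False using \<tau>(3)[OF q] Y(1) by (simp add: N_def)
    qed
    have "\<tau> ^ (p + 1) * (v \<bullet> v) = (\<Sum>b\<in>B. \<tau> ^ (p + 1) * (v \<bullet> b)\<^sup>2)"
      by (simp only: sq[of v] sum_distrib_left)
    also have "\<dots> \<le> (\<Sum>b\<in>B. \<mu> b * (v \<bullet> b)\<^sup>2)"
      using large by (intro sum_mono mult_right_mono) auto
    also have "\<dots> = (\<Sum>b\<in>B. (v \<bullet> b) * (v \<bullet> (V *v b)))"
      by (intro sum.cong) (simp_all add: eig power2_eq_square)
    also have "\<dots> = v \<bullet> (V *v (\<Sum>b\<in>B. (v \<bullet> b) *\<^sub>R b))"
      by (simp add: linear_sum[OF matrix_vector_mul_linear] inner_sum_right matrix_vector_mult_scaleR)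
    finally show ?thesis by (simp only: expand[symmetric])
  qed
  show ?thesis by (rule that[of "\<tau> ^ (p + 1)"]) (use \<tau> main in auto)
qed

section \<open>Existence of a fixed point\<close>

definition weighted_matrix :: "(real \<Rightarrow> real) \<Rightarrow> (real^'p) multiset \<Rightarrow> real^'p^'p \<Rightarrow> real^'p^'p" where
  "weighted_matrix u Z V = (1 / real (size Z)) *\<^sub>R
     (\<Sum>z\<in>#Z. u (z \<bullet> (matrix_inv V *v z)) *\<^sub>R outer_square z)"

lemma outer_square_mult: "outer_square z *v v = (z \<bullet> v) *\<^sub>R z"
  by (simp add: vec_eq_iff outer_square_def matrix_vector_mult_def inner_vec_def
      sum_distrib_left sum_distrib_right mult_ac)

lemma inner_weighted_matrix: "v \<bullet> (weighted_matrix u Z V *v v) = weighted_form u Z V v"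
proof -
  have "v \<bullet> ((\<Sum>z\<in>#W. f z *\<^sub>R outer_square z) *v v) = (\<Sum>z\<in>#W. f z * (z \<bullet> v)\<^sup>2)" for f W
    by (induction W) (simp_all add: matrix_vector_mult_add_rdistrib inner_add_right
        outer_square_mult inner_commute power2_eq_square flip: scaleR_matrix_vector_assoc)
  then show ?thesis
    by (simp add: weighted_matrix_def weighted_form_def flip: scaleR_matrix_vector_assoc)
qed

lemma transpose_weighted_matrix: "transpose (weighted_matrix u Z V) = weighted_matrix u Z V"
proof -
  have "transpose (\<Sum>z\<in>#W. f z *\<^sub>R outer_square z) = (\<Sum>z\<in>#W. f z *\<^sub>R outer_square z)" for f W
    by (induction W) (simp_all add: vec_eq_iff transpose_def outer_square_def mult.commute)
  from this[of "\<lambda>z. u (z \<bullet> (matrix_inv V *v z))" Z] show ?thesis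
    by (simp add: weighted_matrix_def vec_eq_iff transpose_def)
qed

lemma is_scatter_iff_weighted_matrix:
  "is_scatter u t Z V \<longleftrightarrow>
     sym_pos_def V \<and> weighted_matrix u (image_mset (\<lambda>z. z - t) Z) V = V"
  by (auto simp: is_scatter_def weighted_matrix_def image_mset.compositionality comp_def)

text \<open>The Loewner interval between \<open>a\<close> and \<open>C\<close> times the identity.
  It is convex and, for \<open>a \<ge> 0\<close>, compact; a positive \<open>a\<close> keeps it away
  from singular matrices, so it is a suitable domain for Brouwer's theorem.\<close>

definition spd_between :: "real \<Rightarrow> real \<Rightarrow> (real^'p^'p) set" where
  "spd_between a C = {V. transpose V = V \<and> (\<forall>v. a * (v \<bullet> v) \<le> v \<bullet> (V *v v) \<and> v \<bullet> (V *v v) \<le> C * (v \<bullet> v))}"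

lemma spd_between_sym_pos_def:
  assumes "V \<in> spd_between a C" "0 < a"
  shows "sym_pos_def V"
  unfolding sym_pos_def_def
proof (intro conjI allI impI)
  show "transpose V = V" using assms(1) by (simp add: spd_between_def)
  fix x :: "real^'a" assume "x \<noteq> 0"
  then have "0 < a * (x \<bullet> x)" using assms(2) by simp
  also have "\<dots> \<le> x \<bullet> (V *v x)" using assms(1) by (simp add: spd_between_def)
  finally show "0 < x \<bullet> (V *v x)" .
qed

text \<open>For unit vectors \<open>x\<close> and \<open>y\<close> of the standard basis,
  non-negativity of the form at \<open>x + y\<close> and \<open>x - y\<close> bounds twice the entry
  by the sum of two diagonal entries, each at most \<open>C\<close>.\<close>

lemma spd_between_entry_bound:
  fixes V :: "real^'p^'p"
  assumes V: "V \<in> spd_between a C" and a: "0 \<le> a"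
  shows "\<bar>V $ i $ j\<bar> \<le> C"
proof -
  have sym: "transpose V = V" and le: "\<And>v. v \<bullet> (V *v v) \<le> C * (v \<bullet> v)"
    using V by (auto simp: spd_between_def)
  have nn: "0 \<le> v \<bullet> (V *v v)" for v
  proof -
    have "0 \<le> a * (v \<bullet> v)" using a by simp
    also have "\<dots> \<le> v \<bullet> (V *v v)" using V by (simp add: spd_between_def)
    finally show ?thesis .
  qed
  define x :: "real^'p" where "x = axis i 1"
  define y :: "real^'p" where "y = axis j 1"
  have xy: "x \<bullet> x = 1" "y \<bullet> y = 1" by (simp_all add: x_def y_def inner_axis_axis)
  have "V $ i $ j = x \<bullet> (V *v y)"
    by (simp add: x_def y_def inner_axis' matrix_vector_mult_basis column_def)
  moreover have "(x + y) \<bullet> (V *v (x + y)) = x \<bullet> (V *v x) + y \<bullet> (V *v y) + 2 * (x \<bullet> (V *v y))"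
    "(x - y) \<bullet> (V *v (x - y)) = x \<bullet> (V *v x) + y \<bullet> (V *v y) - 2 * (x \<bullet> (V *v y))"
    using inner_sym_matrix[OF sym, of y x]
    by (simp_all add: matrix_vector_right_distrib matrix_vector_mult_diff_distrib
        inner_add_left inner_diff_left inner_add_right inner_diff_right)
  ultimately show ?thesis
    using nn[of "x + y"] nn[of "x - y"] le[of x] le[of y] xy by (auto simp: abs_le_iff)
qed

lemma compact_spd_between:
  assumes "0 \<le> a"
  shows "compact (spd_between a C :: (real^'p^'p) set)"
proof -
  have "continuous_on UNIV (transpose :: real^'p^'p \<Rightarrow> real^'p^'p)"
    unfolding transpose_def by (intro continuous_intros)
  then have "closed (spd_between a C :: (real^'p^'p) set)"
    unfolding spd_between_def
    by (intro closed_Collect_conj closed_Collect_all closed_Collect_eq closed_Collect_le continuous_intros)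
  moreover have "norm V \<le> (\<Sum>i\<in>(UNIV::'p set). \<Sum>j\<in>(UNIV::'p set). C)"
    if "V \<in> spd_between a C" for V :: "real^'p^'p"
  proof -
    have "norm V \<le> (\<Sum>i\<in>UNIV. norm (V $ i))"
      unfolding norm_vec_def[of V] by (rule L2_set_le_sum) simp
    also have "\<dots> \<le> (\<Sum>i\<in>(UNIV::'p set). \<Sum>j\<in>(UNIV::'p set). C)"
    proof (rule sum_mono)
      fix i
      have "norm (V $ i) \<le> (\<Sum>j\<in>UNIV. \<bar>V $ i $ j\<bar>)" by (rule norm_le_l1_cart)
      also have "\<dots> \<le> (\<Sum>j\<in>(UNIV::'p set). C)"
        by (intro sum_mono spd_between_entry_bound[OF that assms])
      finally show "norm (V $ i) \<le> (\<Sum>j\<in>(UNIV::'p set). C)" .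
    qed
    finally show ?thesis .
  qed
  then have "bounded (spd_between a C :: (real^'p^'p) set)"
    unfolding bounded_iff by blast
  ultimately show ?thesis by (simp add: compact_eq_bounded_closed)
qed

lemma convex_spd_between: "convex (spd_between a C)"
proof (rule convexI)
  fix V W :: "real^'a^'a" and x y :: real
  assume V: "V \<in> spd_between a C" and W: "W \<in> spd_between a C" and xy: "0 \<le> x" "0 \<le> y" "x + y = 1"
  have "transpose (x *\<^sub>R V + y *\<^sub>R W) = x *\<^sub>R transpose V + y *\<^sub>R transpose W"
    by (simp add: transpose_def vec_eq_iff)
  moreover have "v \<bullet> ((x *\<^sub>R V + y *\<^sub>R W) *v v) = x * (v \<bullet> (V *v v)) + y * (v \<bullet> (W *v v))" for v
    by (simp add: matrix_vector_mult_add_rdistrib inner_add_right flip: scaleR_matrix_vector_assoc)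
  moreover have "a * (v \<bullet> v) \<le> x * (v \<bullet> (V *v v)) + y * (v \<bullet> (W *v v))"
    "x * (v \<bullet> (V *v v)) + y * (v \<bullet> (W *v v)) \<le> C * (v \<bullet> v)" for v
    using V W xy convex_bound_le[of "v \<bullet> (V *v v)" "C * (v \<bullet> v)" "v \<bullet> (W *v v)" x y]
      convex_bound_le[of "- (v \<bullet> (V *v v))" "- (a * (v \<bullet> v))" "- (v \<bullet> (W *v v))" x y]
    by (auto simp: spd_between_def)
  ultimately show "x *\<^sub>R V + y *\<^sub>R W \<in> spd_between a C"
    using V W by (auto simp: spd_between_def)
qed

section \<open>Continuity and bounds for the fixed-point map\<close>

lemma norm_inv_bound:
  fixes V :: "real^'p^'p"
  assumes V: "sym_pos_def V" and a: "0 < a" "\<And>v. a * (v \<bullet> v) \<le> v \<bullet> (V *v v)"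
  shows "norm (matrix_inv V *v x) \<le> norm x / a"
proof -
  define w where "w = matrix_inv V *v x"
  have "V *v w = x" by (simp add: w_def spd_mult_inv[OF V])
  then have "a * (norm w * norm w) \<le> w \<bullet> x"
    using a(2)[of w] by (simp add: dot_square_norm power2_eq_square)
  also have "\<dots> \<le> norm w * norm x" by (rule norm_cauchy_schwarz)
  finally have "a * norm w \<le> norm x" by (cases "w = 0") auto
  then show ?thesis using a(1) by (simp add: w_def field_simps)
qed

text \<open>The difference of two inverses is the inverse of \<open>V\<close> times
  \<open>V0 - V\<close> times the inverse of \<open>V0\<close>, and the first factor has norm at
  most \<open>1 / a\<close> on the whole interval.\<close>

lemma continuous_on_inv_form:
  fixes z :: "real^'p"
  assumes a: "0 < a"
  shows "continuous_on (spd_between a C) (\<lambda>V. z \<bullet> (matrix_inv V *v z))"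
proof -
  have "((\<lambda>V. matrix_inv V *v z) \<longlongrightarrow> matrix_inv V0 *v z) (at V0 within spd_between a C)"
    if V0: "V0 \<in> spd_between a C" for V0 :: "real^'p^'p"
  proof -
    define w where "w = matrix_inv V0 *v z"
    have "((\<lambda>V. matrix_inv V *v z - w) \<longlongrightarrow> 0) (at V0 within spd_between a C)"
    proof (rule Lim_null_comparison)
      show "\<forall>\<^sub>F V in at V0 within spd_between a C.
          norm (matrix_inv V *v z - w) \<le> norm ((V0 - V) *v w) / a"
        unfolding eventually_at_filter
      proof (intro always_eventually allI impI)
        fix V :: "real^'p^'p" assume V: "V \<in> spd_between a C"
        have spd: "sym_pos_def V" "sym_pos_def V0"
          using V V0 a by (auto intro: spd_between_sym_pos_def)
        have "matrix_inv V *v ((V0 - V) *v w) = matrix_inv V *v z - w"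
          by (simp add: matrix_vector_mult_diff_rdistrib matrix_vector_mult_diff_distrib w_def
              spd_mult_inv[OF spd(1)] spd_mult_inv[OF spd(2)])
        moreover have "norm (matrix_inv V *v ((V0 - V) *v w)) \<le> norm ((V0 - V) *v w) / a"
          using V by (intro norm_inv_bound spd a) (simp add: spd_between_def)
        ultimately show "norm (matrix_inv V *v z - w) \<le> norm ((V0 - V) *v w) / a" by simp
      qed
      have "continuous_on UNIV (\<lambda>V. norm ((V0 - V) *v w) / a)"
        unfolding matrix_vector_mult_def using a by (intro continuous_intros) auto
      then have "((\<lambda>V. norm ((V0 - V) *v w) / a) \<longlongrightarrow> norm ((V0 - V0) *v w) / a) (at V0 within spd_between a C)"
        by (meson UNIV_I continuous_on_def tendsto_within_subset subset_UNIV)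
      then show "((\<lambda>V. norm ((V0 - V) *v w) / a) \<longlongrightarrow> 0) (at V0 within spd_between a C)" by simp
    qed
    then show ?thesis by (simp add: w_def LIM_zero_iff)
  qed
  then show ?thesis unfolding continuous_on_def by (intro ballI tendsto_intros)
qed

text \<open>Nonzero points give positive arguments to \<open>u\<close>, where it is
  continuous.\<close>

lemma continuous_on_weighted_matrix:
  assumes u: "weight_function u" and Z: "0 \<notin># Z" and a: "0 < a"
  shows "continuous_on (spd_between a C) (weighted_matrix u Z)"
proof -
  have cu: "continuous_on {0<..} u" using u unfolding weight_function_def by blast
  have "continuous_on (spd_between a C) (\<lambda>V. \<Sum>z\<in>#W. u (z \<bullet> (matrix_inv V *v z)) *\<^sub>R outer_square z)"
    if "0 \<notin># W" for W :: "(real^'a) multiset"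
    using that
  proof (induction W)
    case (add z W)
    have "continuous_on (spd_between a C) (\<lambda>V. u (z \<bullet> (matrix_inv V *v z)))"
      using add.prems spd_inv_form_pos[OF spd_between_sym_pos_def[OF _ a]]
      by (intro continuous_on_compose2[OF cu continuous_on_inv_form[OF a]]) auto
    moreover have "continuous_on (spd_between a C)
        (\<lambda>V. \<Sum>z\<in>#W. u (z \<bullet> (matrix_inv V *v z)) *\<^sub>R outer_square z)"
      using add by auto
    ultimately show ?case by (simp add: continuous_on_add continuous_on_scaleR)
  qed simp
  from this[OF Z] show ?thesis unfolding weighted_matrix_def by (intro continuous_intros)
qed

lemma weighted_form_nonneg:
  assumes u: "weight_function u" and V: "sym_pos_def V" and Z: "0 \<notin># Z"
  shows "0 \<le> weighted_form u Z V v"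
proof -
  have "(\<Sum>z\<in>#Z. 0) \<le> (\<Sum>z\<in>#Z. u (z \<bullet> (matrix_inv V *v z)) * (z \<bullet> v)\<^sup>2)"
  proof (rule sum_mset_mono)
    fix z assume "z \<in># Z"
    then have "0 \<le> u (z \<bullet> (matrix_inv V *v z))"
      using Z by (intro weight_nonneg[OF u] spd_inv_form_pos[OF V]) auto
    then show "0 \<le> u (z \<bullet> (matrix_inv V *v z)) * (z \<bullet> v)\<^sup>2" by simp
  qed
  then show ?thesis by (simp add: weighted_form_def)
qed

lemma weighted_form_upper_bound:
  fixes Z :: "(real^'p) multiset"
  assumes V: "sym_pos_def V" and Z: "0 \<notin># Z" "Z \<noteq> {#}"
    and M: "0 \<le> M" "\<And>s. 0 < s \<Longrightarrow> u s \<le> M" and R: "\<And>z. z \<in># Z \<Longrightarrow> z \<bullet> z \<le> R"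
  shows "weighted_form u Z V v \<le> M * R * (v \<bullet> v)"
proof -
  have "(\<Sum>z\<in>#Z. u (z \<bullet> (matrix_inv V *v z)) * (z \<bullet> v)\<^sup>2) \<le> (\<Sum>z\<in>#Z. M * (R * (v \<bullet> v)))"
  proof (rule sum_mset_mono)
    fix z assume z: "z \<in># Z"
    have "u (z \<bullet> (matrix_inv V *v z)) \<le> M"
      using z Z by (intro M spd_inv_form_pos[OF V]) auto
    moreover have "(z \<bullet> v)\<^sup>2 \<le> R * (v \<bullet> v)"
      using Cauchy_Schwarz_ineq[of z v] R[OF z] mult_right_mono[OF R[OF z], of "v \<bullet> v"] by simp
    ultimately show "u (z \<bullet> (matrix_inv V *v z)) * (z \<bullet> v)\<^sup>2 \<le> M * (R * (v \<bullet> v))"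
      using M(1) by (intro mult_mono) auto
  qed
  then show ?thesis
    using Z(2) by (simp add: weighted_form_def pos_divide_le_eq nonempty_has_size mult_ac)
qed

text \<open>The perturbed map \<^term>\<open>\<lambda>V. weighted_matrix u Z V + \<delta> *\<^sub>R mat 1\<close> has a fixed point by
  Brouwer's theorem. It is a supersolution, so the assumed lower bound keeps it in a
  compact set independent of \<^term>\<open>\<delta>\<close>.\<close>

lemma weighted_matrix_fixed_point:
  fixes Z :: "(real^'p) multiset"
  assumes u: "weight_function u" and Z: "0 \<notin># Z" "Z \<noteq> {#}" and c: "0 < c"
    and lower: "\<And>V v. sym_pos_def V \<Longrightarrow> (\<And>v. weighted_form u Z V v \<le> v \<bullet> (V *v v)) \<Longrightarrow>
      c * (v \<bullet> v) \<le> v \<bullet> (V *v v)"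
  obtains V where "sym_pos_def V" "weighted_matrix u Z V = V"
proof -
  obtain M where M: "0 < M" "\<And>s. 0 < s \<Longrightarrow> u s \<le> M" using weight_bounded[OF u] by blast
  define R where "R = (\<Sum>z\<in>set_mset Z. z \<bullet> z)"
  have R: "z \<bullet> z \<le> R" if "z \<in># Z" for z
    unfolding R_def using that by (intro member_le_sum) auto
  define C where "C = M * R"
  have ub: "weighted_form u Z V v \<le> C * (v \<bullet> v)" if "sym_pos_def V" for V v
    unfolding C_def using M by (intro weighted_form_upper_bound that Z R) auto
  have C0: "0 \<le> C" using M by (auto simp: C_def R_def intro!: mult_nonneg_nonneg sum_nonneg)
  have pert: "\<exists>V. V \<in> spd_between c (C + 1) \<and> weighted_matrix u Z V + \<delta> *\<^sub>R mat 1 = V"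
    if \<delta>: "0 < \<delta>" "\<delta> \<le> 1" for \<delta>
  proof -
    let ?f = "\<lambda>V. weighted_matrix u Z V + \<delta> *\<^sub>R mat 1"
    have form: "v \<bullet> (?f V *v v) = weighted_form u Z V v + \<delta> * (v \<bullet> v)" for V v
      by (simp add: matrix_vector_mult_add_rdistrib inner_add_right inner_weighted_matrix
          flip: scaleR_matrix_vector_assoc)
    have tr: "transpose (?f V) = ?f V" for V
    proof -
      have "transpose (?f V) = transpose (weighted_matrix u Z V) + \<delta> *\<^sub>R mat 1"
        by (simp add: vec_eq_iff transpose_def mat_def)
      then show ?thesis by (simp add: transpose_weighted_matrix)
    qed
    \<comment> \<open>The weighted form lies between 0 and \<open>C\<close> at every positive
      definite argument, so the perturbed map preserves this Loewner interval.\<close>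
    have maps: "?f V \<in> spd_between \<delta> (C + \<delta>)" if "sym_pos_def V" for V
      using weighted_form_nonneg[OF u that Z(1)] ub[OF that]
      unfolding spd_between_def mem_Collect_eq tr form distrib_right by simp
    have "sym_pos_def (mat 1 :: real^'p^'p)" by (simp add: sym_pos_def_def)
    from maps[OF this] have ne: "spd_between \<delta> (C + \<delta>) \<noteq> ({} :: (real^'p^'p) set)" by auto
    have cont: "continuous_on (spd_between \<delta> (C + \<delta>)) ?f"
      by (intro continuous_intros continuous_on_weighted_matrix u Z \<delta>)
    have self: "?f \<in> spd_between \<delta> (C + \<delta>) \<rightarrow> spd_between \<delta> (C + \<delta>)"
      using maps spd_between_sym_pos_def[OF _ \<delta>(1)] by blast
    have "compact (spd_between \<delta> (C + \<delta>) :: (real^'p^'p) set)"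
      using \<delta> by (intro compact_spd_between) simp
    from brouwer[OF this convex_spd_between ne cont self]
    obtain V where V: "V \<in> spd_between \<delta> (C + \<delta>)" "?f V = V" .
    have spd: "sym_pos_def V" using V(1) \<delta>(1) by (rule spd_between_sym_pos_def)
    have eq: "v \<bullet> (V *v v) = weighted_form u Z V v + \<delta> * (v \<bullet> v)" for v using form[of v V] V(2) by simp
    \<comment> \<open>The perturbation is positive, so this fixed point dominates its weighted form
      and \<open>lower\<close> applies with a constant independent of
      \<open>\<delta>\<close>.\<close>
    have "c * (v \<bullet> v) \<le> v \<bullet> (V *v v)" for v
      using \<delta> by (intro lower spd) (simp add: eq)
    moreover have "v \<bullet> (V *v v) \<le> (C + 1) * (v \<bullet> v)" for v
      using ub[OF spd, of v] mult_right_mono[OF \<delta>(2), of "v \<bullet> v"] by (simp add: eq algebra_simps)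
    ultimately show ?thesis using V(2) spd_sym[OF spd] by (auto simp: spd_between_def)
  qed
  \<comment> \<open>Instead of extracting a convergent subsequence of perturbed fixed points,
    minimise the norm of the fixed-point defect over the compact set. The perturbed solutions show
    that the minimum is 0.\<close>
  have "spd_between c (C + 1) \<noteq> ({} :: (real^'p^'p) set)" using pert[of 1] by auto
  moreover have "compact (spd_between c (C + 1) :: (real^'p^'p) set)"
    using c by (intro compact_spd_between) simp
  moreover have "continuous_on (spd_between c (C + 1)) (\<lambda>V. norm (weighted_matrix u Z V - V))"
    by (intro continuous_intros continuous_on_weighted_matrix u Z c)
  ultimately obtain V where V: "V \<in> spd_between c (C + 1)"
    and min: "\<And>W. W \<in> spd_between c (C + 1) \<Longrightarrow>
      norm (weighted_matrix u Z V - V) \<le> norm (weighted_matrix u Z W - W)"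
    using continuous_attains_inf[of "spd_between c (C + 1)" "\<lambda>V. norm (weighted_matrix u Z V - V)"] by blast
  have small: "norm (weighted_matrix u Z V - V) \<le> \<delta> * norm (mat 1 :: real^'p^'p)" if \<delta>: "0 < \<delta>" "\<delta> \<le> 1" for \<delta>
  proof -
    obtain W where W: "W \<in> spd_between c (C + 1)" "weighted_matrix u Z W + \<delta> *\<^sub>R mat 1 = W"
      using pert[OF \<delta>] by blast
    have "weighted_matrix u Z W - W = - (\<delta> *\<^sub>R mat 1)"
      using W(2) by (metis add_diff_cancel_left' minus_diff_eq)
    then show ?thesis using min[OF W(1)] \<delta> by simp
  qed
  have "norm (weighted_matrix u Z V - V) \<le> 0"
  proof (rule tendsto_lowerbound)
    show "((\<lambda>\<delta>. \<delta> * norm (mat 1 :: real^'p^'p)) \<longlongrightarrow> 0) (at_right 0)"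
      by (intro tendsto_eq_intros) auto
    have "\<forall>\<^sub>F \<delta> in at_right (0::real). \<delta> \<in> {0<..<1}" by (rule eventually_at_right_real) simp
    then show "\<forall>\<^sub>F \<delta> in at_right 0. norm (weighted_matrix u Z V - V) \<le> \<delta> * norm (mat 1 :: real^'p^'p)"
      by eventually_elim (simp add: small)
  qed simp
  then have "weighted_matrix u Z V = V" by simp
  with spd_between_sym_pos_def[OF V c] show ?thesis by (rule that)
qed

section \<open>Uniqueness of the fixed point\<close>

text \<open>A subspace of dimension d > 0 contains at most d data points, and \<open>cond\<close>
  with \<open>q = p - d\<close> turns the count of the others into the claim. For d = 0 every point
  is off \<open>T\<close>, and \<open>K > p\<close> suffices.\<close>

lemma general_position_off_subspace:
  fixes X :: "(real^'p) multiset"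
  assumes gp: "\<And>W. W \<subseteq># X \<Longrightarrow> size W = CARD('p) \<Longrightarrow> span (set_mset W) = UNIV"
    and size: "CARD('p) \<le> size X" and Y0: "0 \<notin># Y"
    and K: "real CARD('p) < K"
    and cond: "\<And>q. 1 \<le> q \<Longrightarrow> q < CARD('p) \<Longrightarrow>
       real (size (X + Y)) * real q < real (size X + q - CARD('p)) * K"
    and T: "subspace T" "dim T < CARD('p)"
  shows "real (size (X + Y)) * real (CARD('p) - dim T) < K * real (size {#z \<in># X + Y. z \<notin> T#})"
proof (cases "dim T = 0")
  case True
  then have T0: "T = {0}" using T(1) by (metis dim_eq_0 subset_singletonD subspace_0 empty_iff)
  have "{#z \<in># X + Y. z \<notin> T#} = X + Y"
    unfolding filter_mset_eq_conv using general_position_nonzero[OF gp size] Y0 by (auto simp: T0)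
  moreover have "0 < real (size (X + Y))"
    using less_le_trans[OF zero_less_card_finite size] by simp
  ultimately show ?thesis using True K by (simp add: mult.commute)
next
  case False
  obtain e where e: "0 < e" "\<And>T. subspace T \<Longrightarrow> dim T < CARD('p) \<Longrightarrow>
      size {#x \<in># X. \<exists>y\<in>T. norm (x - y) < e#} \<le> dim T"
    by (rule general_position_near_subspace[OF gp size]) auto
  have "size {#x \<in># X. x \<in> T#} \<le> size {#x \<in># X. \<exists>y\<in>T. norm (x - y) < e#}"
  proof (rule size_filter_mset_mono)
    fix x assume "x \<in> T"
    then show "\<exists>y\<in>T. norm (x - y) < e" using e(1) by (intro bexI[of _ x]) auto
  qed
  then have "size {#x \<in># X. x \<in> T#} \<le> dim T" using e(2)[OF T] by simp
  then have "size X + (CARD('p) - dim T) - CARD('p) \<le> size {#z \<in># X + Y. z \<notin> T#}"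
    using size_filter_not[of "\<lambda>x. x \<in> T" X] T(2) by simp
  then have "real (size X + (CARD('p) - dim T) - CARD('p)) * K \<le> real (size {#z \<in># X + Y. z \<notin> T#}) * K"
    using K by (intro mult_right_mono) auto
  moreover have "1 \<le> CARD('p) - dim T" "CARD('p) - dim T < CARD('p)" using False T(2) by linarith+
  note cond[OF this]
  ultimately show ?thesis by (simp only: mult.commute[of K])
qed

text \<open>Equality must hold throughout in the comparison of the two fixed-point equations along
  the generalized eigenvectors \<^term>\<open>A\<close> of maximal eigenvalue \<^term>\<open>l > 1\<close>. This forces every
  point either to be orthogonal to \<^term>\<open>A\<close> or to have its weight saturated and concentrated
  on \<^term>\<open>A\<close>, which puts too many points on the orthogonal complement of \<^term>\<open>A\<close>.\<close>

lemma weighted_matrix_fixed_points_le: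
  fixes Z :: "(real^'p) multiset"
  assumes u: "weight_function u" and Z0: "0 \<notin># Z" and K: "0 < psi_sup u"
    and off: "\<And>T. subspace T \<Longrightarrow> dim T < CARD('p) \<Longrightarrow>
      real (size Z) * real (CARD('p) - dim T) < psi_sup u * real (size {#z \<in># Z. z \<notin> T#})"
    and V1: "sym_pos_def V1" "weighted_matrix u Z V1 = V1"
    and V2: "sym_pos_def V2" "weighted_matrix u Z V2 = V2"
  shows "v \<bullet> (V1 *v v) \<le> v \<bullet> (V2 *v v)"
proof -
  obtain B \<mu> where B: "form_orthonormal V2 B" "card B = CARD('p)"
    and eig: "\<And>b. b \<in> B \<Longrightarrow> V1 *v b = \<mu> b *\<^sub>R (V2 *v b)"
    using simultaneous_diagonalization[OF V2(1) spd_sym[OF V1(1)]] by metis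
  have finB: "finite B" using B(1) by (simp add: form_orthonormal_def)
  have neB: "B \<noteq> {}" using B(2) by auto
  have bb: "b \<bullet> (V2 *v b) = 1" if "b \<in> B" for b using B(1) that by (simp add: form_orthonormal_def)
  have pos: "0 < \<mu> b" if "b \<in> B" for b
    using form_orthonormal_inv(1)[OF B V1(1), of \<mu> b] eig that by blast
  define s1 where "s1 z = z \<bullet> (matrix_inv V1 *v z)" for z
  define s2 where "s2 z = z \<bullet> (matrix_inv V2 *v z)" for z
  have s1: "s1 z = (\<Sum>b\<in>B. (z \<bullet> b)\<^sup>2 / \<mu> b)" for z
    unfolding s1_def using form_orthonormal_inv(2)[OF B V1(1), of \<mu> z] eig by blast
  have s2: "s2 z = (\<Sum>b\<in>B. (z \<bullet> b)\<^sup>2)" for z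
    unfolding s2_def using form_orthonormal_inv(2)[OF B V2(1), of "\<lambda>_. 1" z] by simp
  define N where "N = real (size Z)"
  have eq1: "b \<bullet> (V1 *v b) = (\<Sum>z\<in>#Z. u (s1 z) * (z \<bullet> b)\<^sup>2) / N" for b
    using inner_weighted_matrix[of b u Z V1] V1(2) by (simp add: weighted_form_def s1_def N_def)
  have eq2: "b \<bullet> (V2 *v b) = (\<Sum>z\<in>#Z. u (s2 z) * (z \<bullet> b)\<^sup>2) / N" for b
    using inner_weighted_matrix[of b u Z V2] V2(2) by (simp add: weighted_form_def s2_def N_def)
  have N: "0 < N"
  proof -
    obtain b where "b \<in> B" using neB by blast
    from eq2[of b] bb[OF this] have "N \<noteq> 0" by (intro notI) simp
    then show ?thesis by (simp add: N_def nonempty_has_size)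
  qed
  define l where "l = Max (\<mu> ` B)"
  have le_l: "\<mu> b \<le> l" if "b \<in> B" for b using that finB by (simp add: l_def)
  have "l \<le> 1"
  proof (rule ccontr)
    assume "\<not> l \<le> 1"
    then have l: "1 < l" by simp
    define A where "A = {b \<in> B. \<mu> b = l}"
    have AB: "A \<subseteq> B" by (auto simp: A_def)
    have "l \<in> \<mu> ` B" unfolding l_def using finB neB by (intro Max_in) auto
    then have neA: "A \<noteq> {}" by (auto simp: A_def)
    have finA: "finite A" using AB finB finite_subset by blast
    have sat: "u (s2 z) * (\<Sum>b\<in>A. (z \<bullet> b)\<^sup>2) = psi_sup u"
      if z: "z \<in># Z" and a: "a \<in> A" "z \<bullet> a \<noteq> 0" for z a
    proof -
      have aB: "a \<in> B" "\<mu> a = l" using a(1) by (auto simp: A_def)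
      have p1: "0 < s1 w" and p2: "0 < s2 w" and s12: "s2 w / l \<le> s1 w" if "w \<in># Z" for w
      proof -
        have "w \<noteq> 0" using that Z0 by auto
        then show "0 < s1 w" "0 < s2 w"
          unfolding s1_def s2_def by (intro spd_inv_form_pos V1 V2; assumption)+
        show "s2 w / l \<le> s1 w"
          unfolding s1 s2 sum_divide_distrib using pos le_l l
          by (intro sum_mono divide_left_mono) (auto intro!: mult_pos_pos)
      qed
      \<comment> \<open>The first bound uses that \<open>u\<close> decreases. The second uses that
        \<open>psi\<close> increases from \<open>s2 w / l\<close> to \<open>s2 w\<close>, as
        \<open>l > 1\<close>.\<close>
      have chain: "u (s1 w) \<le> u (s2 w / l)" "u (s2 w / l) \<le> l * u (s2 w)" if w: "w \<in># Z" for w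
      proof -
        have pl: "0 < s2 w / l" using p2[OF w] l by simp
        show "u (s1 w) \<le> u (s2 w / l)" by (rule weight_antimono[OF u pl s12[OF w]])
        have "s2 w / l \<le> s2 w" using p2[OF w] l by (simp add: field_simps)
        from psi_mono[OF u pl this] show "u (s2 w / l) \<le> l * u (s2 w)"
          using p2[OF w] l by (simp add: psi_def field_simps)
      qed
      have "u (s1 z) * (z \<bullet> a)\<^sup>2 = l * u (s2 z) * (z \<bullet> a)\<^sup>2"
      proof (rule sum_mset_eq_pointwise[OF _ _ z])
        fix w assume "w \<in># Z"
        from chain[OF this] show "u (s1 w) * (w \<bullet> a)\<^sup>2 \<le> l * u (s2 w) * (w \<bullet> a)\<^sup>2"
          by (intro mult_right_mono) auto
      next
        \<comment> \<open>Since \<open>a\<close> is normalised for \<open>V2\<close> and has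
          relative eigenvalue \<open>l\<close>, both fixed-point equations give the total
          \<open>l * N\<close>. The pointwise inequalities are therefore equalities.\<close>
        have "(\<Sum>w\<in>#Z. l * u (s2 w) * (w \<bullet> a)\<^sup>2) = l * (\<Sum>w\<in>#Z. u (s2 w) * (w \<bullet> a)\<^sup>2)"
          by (simp add: sum_mset_distrib_left mult.assoc)
        also have "\<dots> = l * N" using eq2[of a] bb[OF aB(1)] N by (simp add: field_simps)
        also have "\<dots> = (\<Sum>w\<in>#Z. u (s1 w) * (w \<bullet> a)\<^sup>2)"
          using eq1[of a] bb[OF aB(1)] eig[OF aB(1)] aB(2) N by (simp add: field_simps)
        finally show "(\<Sum>w\<in>#Z. l * u (s2 w) * (w \<bullet> a)\<^sup>2) \<le> (\<Sum>w\<in>#Z. u (s1 w) * (w \<bullet> a)\<^sup>2)" by simp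
      qed
      then have u1: "u (s1 z) = l * u (s2 z)" using a(2) by simp
      then have ul: "u (s2 z / l) = l * u (s2 z)" using chain[OF z] by simp
      have psi2: "psi u (s2 z) = psi_sup u"
      proof -
        have "psi u (s2 z / l) = psi u (s2 z)" using ul l by (simp add: psi_def)
        moreover have "s2 z / l < s2 z" "0 < s2 z / l" using p2[OF z] l by (simp_all add: field_simps)
        ultimately show ?thesis using psi_saturated[OF u, of "s2 z / l" "s2 z"] by simp
      qed
      \<comment> \<open>With \<open>psi\<close> saturated at \<open>s2 z\<close>, this yields the
        reverse of \<open>s12\<close>. Equality there kills the components of \<open>z\<close> along
        eigenvectors with eigenvalue below \<open>l\<close>.\<close>
      have "psi u (s1 z) \<le> psi_sup u" by (rule psi_le_sup[OF u p1[OF z]])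
      then have "s1 z * (l * u (s2 z)) \<le> s2 z * u (s2 z)" using u1 psi2 by (simp add: psi_def)
      moreover have "0 < u (s2 z)"
        using psi2 K p2[OF z] by (metis psi_def zero_less_mult_pos)
      ultimately have "s1 z * l \<le> s2 z" by (simp add: mult.assoc[symmetric])
      then have "s1 z \<le> s2 z / l" using l by (simp add: field_simps)
      then have "s1 z - s2 z / l = 0" using s12[OF z] by simp
      moreover have "s1 z - s2 z / l = (\<Sum>b\<in>B. (z \<bullet> b)\<^sup>2 / \<mu> b - (z \<bullet> b)\<^sup>2 / l)"
        by (simp add: s1 s2 sum_subtractf sum_divide_distrib)
      moreover have term_nonneg: "0 \<le> (z \<bullet> b)\<^sup>2 / \<mu> b - (z \<bullet> b)\<^sup>2 / l" if "b \<in> B" for b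
        using pos[OF that] le_l[OF that] l divide_left_mono[of "\<mu> b" l "(z \<bullet> b)\<^sup>2"] by simp
      ultimately have zero: "(z \<bullet> b)\<^sup>2 / \<mu> b - (z \<bullet> b)\<^sup>2 / l = 0" if "b \<in> B" for b
        using sum_nonneg_eq_0_iff[OF finB, of "\<lambda>b. (z \<bullet> b)\<^sup>2 / \<mu> b - (z \<bullet> b)\<^sup>2 / l"] that by simp
      have "(z \<bullet> b)\<^sup>2 = 0" if "b \<in> B - A" for b
      proof -
        have b: "b \<in> B" "\<mu> b \<noteq> l" using that by (auto simp: A_def)
        have "(z \<bullet> b)\<^sup>2 * (l - \<mu> b) = 0"
          using zero[OF b(1)] pos[OF b(1)] l by (simp add: field_simps)
        then show ?thesis using b(2) by simp
      qed
      then have "(\<Sum>b\<in>B. (z \<bullet> b)\<^sup>2) = (\<Sum>b\<in>A. (z \<bullet> b)\<^sup>2)"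
        by (intro sum.mono_neutral_right finB AB) auto
      then show ?thesis using psi2 by (simp add: psi_def s2 mult.commute)
    qed
    define T where "T = {x. \<forall>a\<in>A. x \<bullet> a = 0}"
    have subT: "subspace T" by (auto simp: T_def subspace_def inner_add_left)
    have "dim {y \<in> UNIV. \<forall>x\<in>span A. orthogonal x y} + dim (span A) = dim (UNIV :: (real^'p) set)"
      by (rule dim_subspace_orthogonal_to_vectors) auto
    moreover have "{y \<in> UNIV. \<forall>x\<in>span A. orthogonal x y} = T"
      by (auto simp: T_def orthogonal_def inner_commute span_base
          intro: orthogonal_to_span[unfolded orthogonal_def])
    moreover have "dim (span A) = card A"
      using independent_mono[OF form_orthonormal_independent[OF B(1)] AB]
      by (simp add: dim_eq_card_independent)
    ultimately have dimT: "dim T + card A = CARD('p)" by simp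
    have cA: "0 < card A" using neA finA by (simp add: card_gt_0_iff)
    \<comment> \<open>Summing the equation for \<open>V2\<close> over \<open>A\<close> counts each
      point off \<open>T\<close> with weight exactly \<open>psi_sup u\<close>, which contradicts the
      strict inequality \<open>off\<close>.\<close>
    have "N * real (card A) = (\<Sum>b\<in>A. N * (b \<bullet> (V2 *v b)))" using bb AB by (simp add: subset_iff)
    also have "\<dots> = (\<Sum>b\<in>A. \<Sum>z\<in>#Z. u (s2 z) * (z \<bullet> b)\<^sup>2)" using eq2 N by simp
    also have "\<dots> = (\<Sum>z\<in>#Z. u (s2 z) * (\<Sum>b\<in>A. (z \<bullet> b)\<^sup>2))"
      by (simp add: sum_sum_mset sum_distrib_left)
    also have "\<dots> = (\<Sum>z\<in>#Z. if z \<notin> T then psi_sup u else 0)"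
    proof (intro arg_cong[of _ _ sum_mset] image_mset_cong)
      fix z assume z: "z \<in># Z"
      show "u (s2 z) * (\<Sum>b\<in>A. (z \<bullet> b)\<^sup>2) = (if z \<notin> T then psi_sup u else 0)"
        using sat[OF z] by (auto simp: T_def)
    qed
    also have "\<dots> = psi_sup u * real (size {#z \<in># Z. z \<notin> T#})" by (rule sum_mset_filter_const)
    finally have "real (size Z) * real (card A) = psi_sup u * real (size {#z \<in># Z. z \<notin> T#})"
      by (simp only: N_def)
    moreover have "dim T < CARD('p)" "CARD('p) - dim T = card A" using dimT cA by simp_all
    ultimately show False using off[OF subT] by simp
  qed
  have "v \<bullet> (V1 *v v) = v \<bullet> (V1 *v (\<Sum>b\<in>B. (b \<bullet> (V2 *v v)) *\<^sub>R b))"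
    by (simp only: form_orthonormal_expand[OF V2(1) B, symmetric])
  also have "\<dots> = (\<Sum>b\<in>B. (b \<bullet> (V2 *v v)) * (v \<bullet> (V1 *v b)))"
    by (simp add: linear_sum[OF matrix_vector_mul_linear] inner_sum_right matrix_vector_mult_scaleR)
  also have "\<dots> = (\<Sum>b\<in>B. \<mu> b * (b \<bullet> (V2 *v v))\<^sup>2)"
    by (intro sum.cong refl) (simp add: eig inner_sym_matrix[OF spd_sym[OF V2(1)], of v] power2_eq_square)
  also have "\<dots> \<le> (\<Sum>b\<in>B. 1 * (b \<bullet> (V2 *v v))\<^sup>2)"
    using le_l \<open>l \<le> 1\<close> by (intro sum_mono mult_right_mono) (auto intro: order_trans)
  also have "\<dots> = (\<Sum>b\<in>B. (b \<bullet> (V2 *v v)) * (v \<bullet> (V2 *v b)))"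
    by (intro sum.cong refl) (simp add: inner_sym_matrix[OF spd_sym[OF V2(1)], of v] power2_eq_square)
  also have "\<dots> = v \<bullet> (V2 *v (\<Sum>b\<in>B. (b \<bullet> (V2 *v v)) *\<^sub>R b))"
    by (simp add: linear_sum[OF matrix_vector_mul_linear] inner_sum_right matrix_vector_mult_scaleR)
  also have "\<dots> = v \<bullet> (V2 *v v)"
    by (simp only: form_orthonormal_expand[OF V2(1) B, symmetric])
  finally show ?thesis .
qed

section \<open>Breakdown\<close>

text \<open>Uniqueness comes from comparing two fixed points in both orders. The constants are
  shared by all \<open>Y\<close> of size \<open>m\<close>, and the bound \<open>R\<close> on the
  contaminating points yields the upper constant \<open>C\<close>.\<close>

lemma scatter_uniform:
  fixes X :: "(real^'p) multiset"
  assumes u: "weight_function u"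
    and gp: "\<And>W. W \<subseteq># X \<Longrightarrow> size W = CARD('p) \<Longrightarrow> span (set_mset W) = UNIV"
    and size: "CARD('p) \<le> size X" and r: "0 < r"
    and K: "real CARD('p) < psi_sup u"
    and cond: "\<And>q. 1 \<le> q \<Longrightarrow> q < CARD('p) \<Longrightarrow>
       real (size X + m) * real q < real (size X + q - CARD('p)) * psi_sup u"
  obtains c C where "0 < c"
    "\<And>Y. size Y = m \<Longrightarrow> (\<And>y. y \<in># Y \<Longrightarrow> r < y \<bullet> y \<and> y \<bullet> y < R) \<Longrightarrow>
       \<exists>!V. sym_pos_def V \<and> weighted_matrix u (X + Y) V = V"
    "\<And>Y V. size Y = m \<Longrightarrow> (\<And>y. y \<in># Y \<Longrightarrow> r < y \<bullet> y \<and> y \<bullet> y < R) \<Longrightarrow>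
       sym_pos_def V \<Longrightarrow> weighted_matrix u (X + Y) V = V \<Longrightarrow> V \<in> spd_between c C"
proof -
  have X0: "0 \<notin># X" by (rule general_position_nonzero[OF gp size])
  obtain c where c: "0 < c" "\<And>Y V v. \<lbrakk>size Y = m; \<And>y. y \<in># Y \<Longrightarrow> r < y \<bullet> y; sym_pos_def V;
     \<And>v. weighted_form u (X + Y) V v \<le> v \<bullet> (V *v v)\<rbrakk> \<Longrightarrow> c * (v \<bullet> v) \<le> v \<bullet> (V *v v)"
    by (rule supersolution_lower_bound[OF u gp size r K cond]) (assumption | blast)+
  obtain M where M: "0 < M" "\<And>s. 0 < s \<Longrightarrow> u s \<le> M" using weight_bounded[OF u] by blast
  define R' where "R' = max R (\<Sum>x\<in>set_mset X. x \<bullet> x)"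
  have ne: "X \<noteq> {#}" using less_le_trans[OF zero_less_card_finite size] by auto
  show ?thesis
  proof (rule that[of c "M * R'"])
    fix Y :: "(real^'p) multiset"
    assume Y: "size Y = m" "\<And>y. y \<in># Y \<Longrightarrow> r < y \<bullet> y \<and> y \<bullet> y < R"
    have Y0: "0 \<notin># Y" using Y(2)[of 0] r by auto
    have Z: "0 \<notin># X + Y" "X + Y \<noteq> {#}" using X0 Y0 ne by auto
    have lower: "c * (v \<bullet> v) \<le> v \<bullet> (V *v v)"
      if "sym_pos_def V" "\<And>v. weighted_form u (X + Y) V v \<le> v \<bullet> (V *v v)" for V v
      using Y by (intro c(2)[OF Y(1) _ that]) auto
    show "\<exists>!V. sym_pos_def V \<and> weighted_matrix u (X + Y) V = V"
    proof (rule ex_ex1I)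
      show "\<exists>V. sym_pos_def V \<and> weighted_matrix u (X + Y) V = V"
        by (rule weighted_matrix_fixed_point[OF u Z c(1) lower]) (assumption | blast)+
    next
      fix V W assume V: "sym_pos_def V \<and> weighted_matrix u (X + Y) V = V"
        and W: "sym_pos_def W \<and> weighted_matrix u (X + Y) W = W"
      have K0: "0 < psi_sup u" using K by (rule le_less_trans[rotated]) simp
      have off: "real (size (X + Y)) * real (CARD('p) - dim T) < psi_sup u * real (size {#z \<in># X + Y. z \<notin> T#})"
        if "subspace T" "dim T < CARD('p)" for T
        using cond Y(1) by (intro general_position_off_subspace gp size Y0 K that) auto
      have eq: "v \<bullet> (V *v v) = v \<bullet> (W *v v)" for v
        using V W by (intro order_antisym weighted_matrix_fixed_points_le[OF u Z(1) K0 off]) auto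
      show "V = W" using V W by (intro sym_matrix_eqI[OF spd_sym spd_sym eq]) blast+
    qed
    fix V assume V: "sym_pos_def V" "weighted_matrix u (X + Y) V = V"
    have eq: "v \<bullet> (V *v v) = weighted_form u (X + Y) V v" for v
      using inner_weighted_matrix[of v u "X + Y" V] V(2) by simp
    have "z \<bullet> z \<le> R'" if "z \<in># X + Y" for z
    proof (cases "z \<in># X")
      case True
      then have "z \<bullet> z \<le> (\<Sum>x\<in>set_mset X. x \<bullet> x)" by (intro member_le_sum) auto
      then show ?thesis by (simp add: R'_def)
    next
      case False
      then show ?thesis using Y(2)[of z] that by (auto simp: R'_def)
    qed
    then have "v \<bullet> (V *v v) \<le> M * R' * (v \<bullet> v)" for v
      unfolding eq using M by (intro weighted_form_upper_bound V Z) auto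
    moreover have "c * (v \<bullet> v) \<le> v \<bullet> (V *v v)" for v
      by (rule lower[OF V(1)]) (simp add: eq)
    ultimately show "V \<in> spd_between c (M * R')"
      using V(1) by (simp add: spd_between_def spd_sym)
  qed (rule c(1))
qed

text \<open>\<open>P\<close> and \<open>Q\<close> will be the inverse scatter matrix and the scatter
  matrix of \<open>X\<close>. Entries of \<open>V\<close> are at most \<open>C\<close>, and those of
  its inverse at most \<open>1 / c\<close>, in absolute value, so the bound is free of
  \<open>V\<close>.\<close>

lemma trace_bound:
  fixes V :: "real^'p^'p"
  assumes V: "V \<in> spd_between c C" and c: "0 < c"
  shows "trace (V ** P + Q ** matrix_inv V)
    \<le> (\<Sum>i\<in>UNIV. \<Sum>j\<in>UNIV. C * \<bar>P $ j $ i\<bar>) + (\<Sum>i\<in>UNIV. \<Sum>j\<in>UNIV. \<bar>Q $ i $ j\<bar> * (1 / c))"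
proof -
  have inv: "\<bar>matrix_inv V $ j $ i\<bar> \<le> 1 / c" for i j
  proof -
    have "\<bar>matrix_inv V $ j $ i\<bar> = \<bar>(matrix_inv V *v axis i 1) $ j\<bar>"
      by (simp add: matrix_vector_mult_basis column_def)
    also have "\<dots> \<le> norm (matrix_inv V *v axis i 1)" by (rule component_le_norm_cart)
    also have "\<dots> \<le> norm (axis i 1 :: real^'p) / c"
      using V by (intro norm_inv_bound spd_between_sym_pos_def[OF V c] c) (simp add: spd_between_def)
    finally show ?thesis by simp
  qed
  have "trace (V ** P + Q ** matrix_inv V) =
      (\<Sum>i\<in>UNIV. \<Sum>j\<in>UNIV. V $ i $ j * P $ j $ i) + (\<Sum>i\<in>UNIV. \<Sum>j\<in>UNIV. Q $ i $ j * matrix_inv V $ j $ i)"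
    by (simp add: trace_def matrix_matrix_mult_def sum.distrib)
  also have "\<dots> \<le> (\<Sum>i\<in>UNIV. \<Sum>j\<in>UNIV. C * \<bar>P $ j $ i\<bar>) + (\<Sum>i\<in>UNIV. \<Sum>j\<in>UNIV. \<bar>Q $ i $ j\<bar> * (1 / c))"
  proof (intro add_mono sum_mono)
    fix i j
    have "V $ i $ j * P $ j $ i \<le> \<bar>V $ i $ j\<bar> * \<bar>P $ j $ i\<bar>" by (metis abs_ge_self abs_mult)
    also have "\<dots> \<le> C * \<bar>P $ j $ i\<bar>"
      using c by (intro mult_right_mono spd_between_entry_bound[OF V]) auto
    finally show "V $ i $ j * P $ j $ i \<le> C * \<bar>P $ j $ i\<bar>" .
    have "Q $ i $ j * matrix_inv V $ j $ i \<le> \<bar>Q $ i $ j\<bar> * \<bar>matrix_inv V $ j $ i\<bar>"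
      by (metis abs_ge_self abs_mult)
    also have "\<dots> \<le> \<bar>Q $ i $ j\<bar> * (1 / c)" using inv by (intro mult_left_mono) auto
    finally show "Q $ i $ j * matrix_inv V $ j $ i \<le> \<bar>Q $ i $ j\<bar> * (1 / c)" .
  qed
  finally show ?thesis .
qed

text \<open>Take the trace of the fixed-point equation on the \<^term>\<open>V\<close>-orthogonal complement of the line.\<close>

lemma weighted_matrix_fixed_point_line:
  fixes Z :: "(real^'p) multiset"
  assumes u: "weight_function u" and Z0: "0 \<notin># Z"
    and V: "sym_pos_def V" "weighted_matrix u Z V = V"
  shows "real (size Z) * real (CARD('p) - 1) \<le> psi_sup u * real (size {#z \<in># Z. z \<notin> span {x}#})"
proof -
  \<comment> \<open>Diagonalizing the rank-one matrix \<open>outer_square x\<close> relative to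
    \<open>V\<close> gives a basis in which at most one vector is not orthogonal to
    \<open>x\<close>.\<close>
  have "transpose (outer_square x) = outer_square x"
    by (simp add: transpose_def outer_square_def vec_eq_iff mult.commute)
  then obtain B \<mu> where B: "form_orthonormal V B" "card B = CARD('p)"
    and eig: "\<And>b. b \<in> B \<Longrightarrow> outer_square x *v b = \<mu> b *\<^sub>R (V *v b)"
    using simultaneous_diagonalization[OF V(1)] by metis
  have finB: "finite B" using B(1) by (simp add: form_orthonormal_def)
  define A where "A = {b \<in> B. x \<bullet> b = 0}"
  have AB: "A \<subseteq> B" by (auto simp: A_def)
  have finA: "finite A" using AB finB finite_subset by blast
  have "b = b'" if b: "b \<in> B - A" "b' \<in> B - A" for b b'
  proof (rule ccontr)
    assume "b \<noteq> b'"
    then have "b' \<bullet> (V *v b) = 0" using b B(1) by (auto simp: form_orthonormal_def)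
    then have "b' \<bullet> (outer_square x *v b) = 0" using eig[of b] b(1) by simp
    then have "(x \<bullet> b) * (b' \<bullet> x) = 0" by (simp only: outer_square_mult inner_scaleR_right)
    then show False using b by (auto simp: A_def inner_commute)
  qed
  then have "card (B - A) \<le> 1" using finB by (auto simp: card_le_Suc0_iff_eq)
  then have cA: "CARD('p) - 1 \<le> card A" using card_Diff_subset[OF finA AB] B(2) by simp
  define s where "s z = z \<bullet> (matrix_inv V *v z)" for z
  have s: "s z = (\<Sum>b\<in>B. (z \<bullet> b)\<^sup>2)" for z
    unfolding s_def using form_orthonormal_inv(2)[OF B V(1), of "\<lambda>_. 1" z] by simp
  define N where "N = real (size Z)"
  have N: "N * (b \<bullet> (V *v b)) = (\<Sum>z\<in>#Z. u (s z) * (z \<bullet> b)\<^sup>2)" for b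
    using inner_weighted_matrix[of b u Z V] V(2)
    by (cases "Z = {#}") (simp_all add: weighted_form_def s_def N_def nonempty_has_size field_simps)
  have "N * real (CARD('p) - 1) \<le> N * real (card A)"
    using cA by (intro mult_left_mono) (auto simp: N_def)
  also have "\<dots> = (\<Sum>b\<in>A. N * (b \<bullet> (V *v b)))"
    using B(1) AB by (simp add: form_orthonormal_def subset_iff)
  also have "\<dots> = (\<Sum>z\<in>#Z. u (s z) * (\<Sum>b\<in>A. (z \<bullet> b)\<^sup>2))"
    unfolding N by (simp add: sum_sum_mset sum_distrib_left)
  \<comment> \<open>Points on the line are orthogonal to \<open>A\<close> and contribute nothing.
    Any other point contributes at most \<open>psi u (s z)\<close>.\<close>
  also have "\<dots> \<le> (\<Sum>z\<in>#Z. if z \<notin> span {x} then psi_sup u else 0)"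
  proof (rule sum_mset_mono)
    fix z assume "z \<in># Z"
    then have "z \<noteq> 0" using Z0 by auto
    then have sz: "0 < s z" unfolding s_def by (rule spd_inv_form_pos[OF V(1)])
    show "u (s z) * (\<Sum>b\<in>A. (z \<bullet> b)\<^sup>2) \<le> (if z \<notin> span {x} then psi_sup u else 0)"
    proof (cases "z \<in> span {x}")
      case True
      then obtain k where "z = k *\<^sub>R x" by (auto simp: span_singleton)
      then show ?thesis using True by (simp add: A_def)
    next
      case False
      have "(\<Sum>b\<in>A. (z \<bullet> b)\<^sup>2) \<le> s z" unfolding s by (intro sum_mono2 finB AB) auto
      then have "u (s z) * (\<Sum>b\<in>A. (z \<bullet> b)\<^sup>2) \<le> u (s z) * s z"
        using weight_nonneg[OF u sz] by (intro mult_left_mono)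
      also have "\<dots> \<le> psi_sup u" using psi_le_sup[OF u sz] by (simp add: psi_def mult.commute)
      finally show ?thesis using False by simp
    qed
  qed
  also have "\<dots> = psi_sup u * real (size {#z \<in># Z. z \<notin> span {x}#})" by (rule sum_mset_filter_const)
  finally show ?thesis by (simp add: N_def)
qed

section \<open>Translation to the centre, and the two sides of the breakdown threshold\<close>

lemma general_position_centred:
  fixes X :: "(real^'p) multiset"
  assumes "general_position_about t X"
    and W: "W \<subseteq># image_mset (\<lambda>x. x - t) X" "size W = CARD('p)"
  shows "span (set_mset W) = UNIV"
proof -
  have "image_mset (\<lambda>w. w + t) W \<subseteq># X"
    using image_mset_subseteq_mono[OF W(1), of "\<lambda>w. w + t"]
    by (simp add: image_mset.compositionality comp_def)
  then have "span ((\<lambda>x. x - t) ` set_mset (image_mset (\<lambda>w. w + t) W)) = UNIV"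
    using assms(1) W(2) unfolding general_position_about_def by (metis size_image_mset)
  then show ?thesis by (simp add: image_image)
qed

text \<open>For nonempty \<open>Y\<close> the sets under \<open>Min\<close> and \<open>Max\<close>
  are finite and nonempty; an empty \<open>Y\<close> is excluded on both sides by
  \<open>size Y = m\<close>.\<close>

lemma in_C2_C3_iff:
  assumes "1 \<le> m"
  shows "Y \<in> C2 t r m \<inter> C3 t B m \<longleftrightarrow>
    size Y = m \<and> (\<forall>y\<in>#Y. r < (y - t) \<bullet> (y - t) \<and> (y - t) \<bullet> (y - t) < B)"
proof (cases "Y = {#}")
  case False
  then have "(\<lambda>y. (y - t) \<bullet> (y - t)) ` set_mset Y \<noteq> {}" by simp
  then show ?thesis by (auto simp: C2_def C3_def)
next
  case True
  then show ?thesis using assms by (auto simp: C2_def C3_def)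
qed

text \<open>After translation of \<open>t\<close> to the origin, \<open>scatter_uniform\<close>
  makes the definite description in \<open>scatter\<close> well defined and puts the scatter
  matrices of all contaminated samples into one Loewner interval, so the traces are bounded.\<close>

lemma breakdown_bias_finite:
  fixes X :: "(real^'p) multiset"
  assumes u: "weight_function u" and gp: "general_position_about t X"
    and size: "CARD('p) \<le> size X" and r: "0 < r" and m: "1 \<le> m"
    and K: "real CARD('p) < psi_sup u"
    and cond: "\<And>q. 1 \<le> q \<Longrightarrow> q < CARD('p) \<Longrightarrow>
       real (size X + m) * real q < real (size X + q - CARD('p)) * psi_sup u"
  shows "breakdown_bias u t X (C2 t r m \<inter> C3 t B m) < \<infinity>"
proof -
  define X' where "X' = image_mset (\<lambda>x. x - t) X"
  have gp': "span (set_mset W) = UNIV" if "W \<subseteq># X'" "size W = CARD('p)" for W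
    using general_position_centred[OF gp] that unfolding X'_def by blast
  have size': "CARD('p) \<le> size X'" using size by (simp add: X'_def)
  have cond': "real (size X' + m) * real q < real (size X' + q - CARD('p)) * psi_sup u"
    if "1 \<le> q" "q < CARD('p)" for q
    using cond[OF that] by (simp add: X'_def)
  obtain c C where c: "0 < c"
    and ex1: "\<And>Y. size Y = m \<Longrightarrow> (\<And>y. y \<in># Y \<Longrightarrow> r < y \<bullet> y \<and> y \<bullet> y < B) \<Longrightarrow>
       \<exists>!V. sym_pos_def V \<and> weighted_matrix u (X' + Y) V = V"
    and between: "\<And>Y V. size Y = m \<Longrightarrow> (\<And>y. y \<in># Y \<Longrightarrow> r < y \<bullet> y \<and> y \<bullet> y < B) \<Longrightarrow>
       sym_pos_def V \<Longrightarrow> weighted_matrix u (X' + Y) V = V \<Longrightarrow> V \<in> spd_between c C"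
    by (rule scatter_uniform[OF u gp' size' r K cond', where R = B]) (assumption | blast)+
  have unique: "\<exists>!V. is_scatter u t (X + Y) V" and bounds: "scatter u t (X + Y) \<in> spd_between c C"
    if Y: "Y \<in> C2 t r m \<inter> C3 t B m" for Y
  proof -
    let ?Y = "image_mset (\<lambda>y. y - t) Y"
    have Y': "size ?Y = m" "\<And>y. y \<in># ?Y \<Longrightarrow> r < y \<bullet> y \<and> y \<bullet> y < B"
      using Y unfolding in_C2_C3_iff[OF m] by auto
    have iff: "is_scatter u t (X + Y) V \<longleftrightarrow> sym_pos_def V \<and> weighted_matrix u (X' + ?Y) V = V" for V
      by (simp add: is_scatter_iff_weighted_matrix X'_def)
    show *: "\<exists>!V. is_scatter u t (X + Y) V" unfolding iff by (rule ex1[OF Y'])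
    have "is_scatter u t (X + Y) (scatter u t (X + Y))"
      unfolding scatter_def by (rule theI'[OF *])
    then have "sym_pos_def (scatter u t (X + Y))"
      "weighted_matrix u (X' + ?Y) (scatter u t (X + Y)) = scatter u t (X + Y)"
      unfolding iff by auto
    from between[OF Y' this] show "scatter u t (X + Y) \<in> spd_between c C" .
  qed
  define D where "D = (\<Sum>i\<in>UNIV. \<Sum>j\<in>UNIV. C * \<bar>matrix_inv (scatter u t X) $ j $ i\<bar>)
    + (\<Sum>i\<in>UNIV. \<Sum>j\<in>UNIV. \<bar>scatter u t X $ i $ j\<bar> * (1 / c))"
  have "\<not> (\<exists>Y\<in>C2 t r m \<inter> C3 t B m. \<not> scatter_exists u t (X + Y))"
    using ex1_implies_ex[OF unique] unfolding scatter_exists_def by blast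
  moreover have "trace (scatter u t (X + Y) ** matrix_inv (scatter u t X)
      + scatter u t X ** matrix_inv (scatter u t (X + Y))) \<le> D" if "Y \<in> C2 t r m \<inter> C3 t B m" for Y
    unfolding D_def by (rule trace_bound[OF bounds[OF that] c])
  ultimately have "breakdown_bias u t X (C2 t r m \<inter> C3 t B m) \<le> ereal D"
    unfolding breakdown_bias_def by (simp only: if_False) (intro SUP_least, simp)
  then show ?thesis by (rule le_less_trans) simp
qed

text \<open>All contaminating points are placed on the line through \<^term>\<open>t\<close> and one of the data points.\<close>

lemma breakdown_bias_infinite:
  fixes X :: "(real^'p) multiset"
  assumes u: "weight_function u" and gp: "general_position_about t X"
    and size: "CARD('p) \<le> size X" and r: "0 < r" and m: "1 \<le> m"
    and ne: "C2 t r m \<inter> C3 t B m \<noteq> {}" and K: "0 \<le> psi_sup u"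
    and many: "real (size X - 1) * psi_sup u < real (size X + m) * real (CARD('p) - 1)"
  shows "breakdown_bias u t X (C2 t r m \<inter> C3 t B m) = \<infinity>"
proof -
  obtain Y0 where Y0: "Y0 \<in> C2 t r m \<inter> C3 t B m" using ne by blast
  then have Y0': "size Y0 = m" "\<forall>y\<in>#Y0. r < (y - t) \<bullet> (y - t) \<and> (y - t) \<bullet> (y - t) < B"
    unfolding in_C2_C3_iff[OF m] by auto
  then obtain y0 where "y0 \<in># Y0" using m by (metis multiset_nonemptyE not_one_le_zero size_empty)
  with Y0' have y0: "r < (y0 - t) \<bullet> (y0 - t)" "(y0 - t) \<bullet> (y0 - t) < B" by auto
  define X' where "X' = image_mset (\<lambda>x. x - t) X"
  have X'0: "0 \<notin># X'"
    unfolding X'_def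
    by (rule general_position_nonzero) (use general_position_centred[OF gp] size in auto)
  have "X \<noteq> {#}" using less_le_trans[OF zero_less_card_finite size] by auto
  then obtain x1 where x1: "x1 \<in># X" by auto
  define x where "x = x1 - t"
  have x: "x \<in># X'" using x1 by (simp add: X'_def x_def)
  then have x0: "x \<noteq> 0" using X'0 by auto
  \<comment> \<open>\<open>w\<close> lies on the line of the data point \<open>x\<close> and has the
    length of an admissible contaminating vector, so it respects both \<open>r\<close> and
    \<open>B\<close>.\<close>
  define w where "w = (norm (y0 - t) / norm x) *\<^sub>R x"
  have ww: "w \<bullet> w = (y0 - t) \<bullet> (y0 - t)"
    using x0 by (simp add: w_def dot_square_norm power2_eq_square)
  define Y where "Y = replicate_mset m (t + w)"
  have Y: "Y \<in> C2 t r m \<inter> C3 t B m"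
    unfolding in_C2_C3_iff[OF m] using y0 ww by (auto simp: Y_def)
  have Y': "image_mset (\<lambda>y. y - t) Y = replicate_mset m w" by (simp add: Y_def)
  let ?P = "\<lambda>z. z \<notin> span {x}"
  have "size (filter_mset ?P (replicate_mset m w)) = 0"
  proof -
    have "w \<in> span {x}" unfolding w_def by (intro span_scale span_base) simp
    then show ?thesis by (induction m) simp_all
  qed
  \<comment> \<open>The data point \<open>x\<close> itself lies on the line, hence the subtraction
    of 1.\<close>
  moreover have "size (filter_mset ?P X') \<le> size X - 1"
  proof -
    obtain X1 where X1: "X' = add_mset x X1" using x by (meson multi_member_split)
    have "filter_mset ?P X' = filter_mset ?P X1" using X1 by (simp add: span_base)
    also have "size \<dots> \<le> size X1" by (rule size_filter_mset_lesseq)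
    also have "size X1 = size X - 1" using arg_cong[OF X1, of size] by (simp add: X'_def)
    finally show ?thesis .
  qed
  ultimately have few: "size (filter_mset ?P (X' + replicate_mset m w)) \<le> size X - 1"
    by (simp only: filter_union_mset size_union)
  have "\<not> is_scatter u t (X + Y) V" for V
  proof
    assume "is_scatter u t (X + Y) V"
    then have V: "sym_pos_def V" "weighted_matrix u (X' + replicate_mset m w) V = V"
      by (simp_all add: is_scatter_iff_weighted_matrix X'_def Y')
    have "w \<noteq> 0" using ww y0 r by auto
    then have "0 \<notin># X' + replicate_mset m w" using X'0 by auto
    from weighted_matrix_fixed_point_line[OF u this V, of x]
    have "real (size X + m) * real (CARD('p) - 1)
      \<le> psi_sup u * real (size (filter_mset ?P (X' + replicate_mset m w)))"
      by (simp add: X'_def)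
    also have "\<dots> \<le> psi_sup u * real (size X - 1)"
      using few K by (intro mult_left_mono) auto
    finally show False using many by (simp add: mult.commute)
  qed
  then have "\<not> scatter_exists u t (X + Y)" by (simp add: scatter_exists_def)
  then show ?thesis using Y unfolding breakdown_bias_def by auto
qed

section \<open>Comparison of the four thresholds\<close>

theorem theorem4p2:
  fixes u :: "real \<Rightarrow> real" and t :: "real^'p" and X :: "(real^'p) multiset"
    and n p K a1 a2 a3 a4 r B :: real
  assumes n_def: "n = real (size X)"
    and p_def: "p = real CARD('p)"
    and K_def: "K = psi_sup u"
    and u: "weight_function u"
    and K: "K > p"
    and gen_pos: "general_position_about t X"
    and n_gt: "n > p * (p - 1)"
    and a1_def: "a1 = 1 - n * p / (n * K - (K - n) * (p - 1))"
    and a2_def: "a2 = 1 - n * p / (n * K + n - K)"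
    and a3_def: "a3 = 1 - n * (p - 1) / ((n - p + 1) * K)"
    and a4_def: "a4 = 1 - n * (p - 1) / ((n - 1) * K)"
    and r: "r > 0"
  shows "(n > K \<longrightarrow> breakdown_fraction_between u t X (\<lambda>m. C2 t r m \<inter> C3 t B m) (min a2 a3) a4)
       \<and> (n \<le> K \<longrightarrow> breakdown_fraction_between u t X (\<lambda>m. C2 t r m \<inter> C3 t B m) a1 a4)"
proof -
  have p1: "1 \<le> p" by (simp add: p_def Suc_leI)
  \<comment> \<open>For \<open>p = 1\<close> the hypothesis makes \<open>n\<close> a positive
    integer; for \<open>p \<ge> 2\<close> it gives \<open>n > p\<close>.\<close>
  have np: "p \<le> n" and n1: "p = 1 \<or> 2 \<le> p \<and> 1 < n"
  proof -
    have "p = 1 \<or> 2 \<le> p"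
    proof -
      have "CARD('p) = 1 \<or> 2 \<le> CARD('p)" using zero_less_card_finite[where 'a='p] by linarith
      then show ?thesis by (auto simp: p_def)
    qed
    moreover have "p \<le> n" if "p = 1"
      using n_gt that by (simp add: n_def)
    moreover have "p < n" if "2 \<le> p"
    proof -
      have "p * 1 \<le> p * (p - 1)" using that by (intro mult_left_mono) auto
      then show ?thesis using n_gt by simp
    qed
    ultimately show "p \<le> n" "p = 1 \<or> 2 \<le> p \<and> 1 < n" by fastforce+
  qed
  have size: "CARD('p) \<le> size X" using np by (simp add: n_def p_def)
  have K0: "0 < K" using K p1 by simp
  \<comment> \<open>One statement covers both lower bounds. For \<open>p = 1\<close> no comparison
    with \<open>a4\<close> is required, because the range of \<open>q\<close> is empty and the bias
    is always finite.\<close>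
  have main: "breakdown_fraction_between u t X (\<lambda>m. C2 t r m \<inter> C3 t B m) L a4"
    if L: "p \<noteq> 1 \<Longrightarrow> L \<le> a4" for L
    unfolding breakdown_fraction_between_def
  proof (intro allI impI conjI)
    fix m :: nat assume m: "1 \<le> m" and ne: "C2 t r m \<inter> C3 t B m \<noteq> {}"
    define N where "N = real (size X + m)"
    have N: "n < N" using m by (simp add: N_def n_def)
    then have N0: "0 < N" using np p1 by simp
    have frac: "contam_frac X m = 1 - n / N"
      using N0 by (simp add: contam_frac_def N_def n_def field_simps)
    show "breakdown_bias u t X (C2 t r m \<inter> C3 t B m) < \<infinity>" if lt: "contam_frac X m < L"
    proof (rule breakdown_bias_finite[OF u gen_pos size r m])
      show "real CARD('p) < psi_sup u" using K by (simp add: K_def p_def)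
      fix q :: nat assume q: "1 \<le> q" "q < CARD('p)"
      have p2: "2 \<le> p" using q n1 by (auto simp: p_def)
      then have n2: "1 < n" using n1 by auto
      have "1 - n / N < 1 - n * (p - 1) / ((n - 1) * K)"
        using lt L p2 by (simp add: frac a4_def)
      then have "n * ((p - 1) / ((n - 1) * K)) < n * (1 / N)" by simp
      then have "(p - 1) / ((n - 1) * K) < 1 / N"
        by (rule mult_left_less_imp_less) (use n2 in simp)
      then have less: "N * (p - 1) < (n - 1) * K"
        using N0 n2 K0 by (simp add: field_simps)
      have "N * real q * (p - 1) = real q * (N * (p - 1))" by simp
      also have "\<dots> < real q * ((n - 1) * K)" using less q by (intro mult_strict_left_mono) auto
      \<comment> \<open>The condition for \<open>q = p - 1\<close> is the strongest: the two sides
        differ by \<open>(n - p) * (p - 1 - q)\<close> times \<open>K\<close>.\<close>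
      also have "\<dots> \<le> (n + real q - p) * K * (p - 1)"
      proof -
        have "real q \<le> p - 1" using q by (simp add: p_def)
        then have "0 \<le> (n - p) * (p - 1 - real q)" using np by (intro mult_nonneg_nonneg) auto
        then have "real q * (n - 1) \<le> (n + real q - p) * (p - 1)" by (simp add: algebra_simps)
        from mult_right_mono[OF this, of K] K0 show ?thesis by (simp add: mult_ac)
      qed
      finally have "N * real q < (n + real q - p) * K" using p2 by simp
      moreover have "n + real q - p = real (size X + q - CARD('p))"
        using size by (simp add: n_def p_def of_nat_diff)
      ultimately show "real (size X + m) * real q < real (size X + q - CARD('p)) * psi_sup u"
        by (simp add: N_def K_def)
    qed
    show "breakdown_bias u t X (C2 t r m \<inter> C3 t B m) = \<infinity>" if gt: "a4 < contam_frac X m"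
    proof (rule breakdown_bias_infinite[OF u gen_pos size r m ne])
      show "0 \<le> psi_sup u" using K0 by (simp add: K_def)
      \<comment> \<open>For \<open>p = 1\<close> the threshold \<open>a4\<close> equals 1, which no
        contamination fraction exceeds.\<close>
      have "0 < n / N" using N0 np p1 by simp
      then have p2: "2 \<le> p" "1 < n" using gt n1 by (auto simp: a4_def frac)
      have "n * (1 / N) < n * ((p - 1) / ((n - 1) * K))"
        using gt by (simp add: frac a4_def)
      then have "1 / N < (p - 1) / ((n - 1) * K)"
        by (rule mult_left_less_imp_less) (use p2 in simp)
      then have "(n - 1) * K < N * (p - 1)"
        using N0 p2 K0 by (simp add: field_simps)
      moreover have "n - 1 = real (size X - 1)" "p - 1 = real (CARD('p) - 1)"
        using p2(2) by (simp_all add: n_def p_def of_nat_diff Suc_leI)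
      ultimately show "real (size X - 1) * psi_sup u < real (size X + m) * real (CARD('p) - 1)"
        by (simp add: N_def K_def)
    qed
  qed
  have "min a2 a3 \<le> a4" if "p \<noteq> 1"
  proof -
    have p2: "2 \<le> p" "1 < n" using n1 that by auto
    \<comment> \<open>As \<open>p \<ge> 2\<close>, the denominator in \<open>a3\<close> is at most
      the one in \<open>a4\<close>.\<close>
    have "n * (p - 1) / ((n - 1) * K) \<le> n * (p - 1) / ((n - p + 1) * K)"
      using p2 np K0 by (intro divide_left_mono mult_right_mono mult_pos_pos mult_nonneg_nonneg) auto
    then have "a3 \<le> a4" by (simp add: a3_def a4_def)
    then show ?thesis by simp
  qed
  moreover have "a1 \<le> a4" if "p \<noteq> 1" "n \<le> K"
  proof -
    have p2: "2 \<le> p" "1 < n" using n1 that by auto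
    \<comment> \<open>The denominator in \<open>a1\<close>; its rewritten form shows that it is
      positive.\<close>
    define D where "D = n * K - (K - n) * (p - 1)"
    have "D = K * (n - p + 1) + n * (p - 1)" by (simp add: D_def algebra_simps)
    then have D: "0 < D" using K0 np p2 by (simp add: add_pos_pos)
    \<comment> \<open>This expression equals \<open>p * ((n - 1) * K) - (p - 1) * D\<close>, and
      \<open>n \<le> K\<close> makes its second summand non-negative.\<close>
    have "0 \<le> (n - p) * K + (K - n) * (p - 1) * (p - 1)"
      using np K0 that p2 by (intro add_nonneg_nonneg mult_nonneg_nonneg) auto
    then have "(p - 1) * D \<le> p * ((n - 1) * K)" by (simp add: D_def algebra_simps)
    then have "(p - 1) / ((n - 1) * K) \<le> p / D"
      using D p2 K0 by (simp add: pos_divide_le_eq pos_le_divide_eq)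
    then have "n * ((p - 1) / ((n - 1) * K)) \<le> n * (p / D)"
      using p2 by (intro mult_left_mono) auto
    then show ?thesis by (simp add: a1_def a4_def D_def)
  qed
  ultimately show ?thesis using main by blast
qed

end
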